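(* Let $\psi:\mathbb{T}^{d-1}\times\mathbb{R}\to\mathbb{T}^{d-1}\times\mathbb{R}$ be of the form $\psi(\sigma,t)=(v(\sigma),a(\sigma)t)$ with $v\in\mathscr{C}^r(\mathbb{T}^{d-1},\mathbb{T}^{d-1})$ a diffeomorphism and $a\in\mathscr{C}^r(\mathbb{T}^{d-1},\mathbb{R}\setminus\{0\})$. Assume that there exist a diffeomorphism $h\in\mathscr{C}^r(\mathbb{T}^{d-1},\mathbb{T}^{d-1})$ and a vector $\Omega\in\mathscr{D}_{d-1}(\nu,\tau)$ such that $$h^{-1}\circ v\circ h(\sigma)=\sigma+\Omega .$$ Assume further that $\tau<r$. Then there exist a function $b\in\mathscr{C}^{r-\tau}(\mathbb{T}^{d-1},\mathbb{R}\setminus\{0\})$ and a constant $\kappa\in\mathbb{R}\setminus\{0\}$ such that the diffeomorphism $H(\sigma,t)=(h(\sigma),b(\sigma)t)$ satisfies $$\psi\circ H(\sigma,t)=H(\sigma+\Omega,\kappa t).$$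
   Context: $\mathbb{T}^{s}=\mathbb{R}^s/\mathbb{Z}^s$. $\mathscr{D}_{s}(\nu,\tau)$ is the set of vectors $\omega\in\mathbb{R}^s$ satisfying the Diophantine condition of type $(\nu,\tau)$: $|k\cdot\omega-n|\ge\nu|k|^{-\tau}$ for all $k\in\mathbb{Z}^s\setminus\{0\}$ and $n\in\mathbb{Z}$. $\mathscr{C}^r$ denotes $r$ times continuously differentiable functions (Hölder classes for non-integer exponents).
   Formalization: When r−τ is an integer the claim b ∈ C^{r−τ} is false in general; there the formal theorem gives a single b (with κ and H) of class C^ρ for every 0 < ρ < r−τ, and for non-integer r−τ it gives b ∈ C^{r−τ} as stated. *)

theory Defs
  imports "HOL-Analysis.Analysis"
begin

section \<open>The torus\<close>

text \<open>The torus \<open>\<real>\<^sup>s / \<int>\<^sup>s\<close> with \<open>s = CARD('n)\<close>, as a quotient group of \<open>\<real>\<^sup>s\<close>.\<close>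

definition int_equiv :: "real ^ 'n \<Rightarrow> real ^ 'n \<Rightarrow> bool" where
  "int_equiv x y \<longleftrightarrow> (\<forall>i. x $ i - y $ i \<in> \<int>)"

lemma int_equiv_refl: "int_equiv x x"
  by (simp add: int_equiv_def)

lemma int_equiv_sym: "int_equiv x y \<Longrightarrow> int_equiv y x"
  unfolding int_equiv_def by (metis Ints_minus minus_diff_eq)

lemma int_equiv_add:
  assumes "int_equiv x y" and "int_equiv u w"
  shows "int_equiv (x + u) (y + w)"
  unfolding int_equiv_def
proof
  fix i
  have "(x $ i - y $ i) + (u $ i - w $ i) \<in> \<int>"
    using assms by (auto simp: int_equiv_def)
  then show "(x + u) $ i - (y + w) $ i \<in> \<int>"
    by (simp add: algebra_simps)
qed

lemma int_equiv_uminus: "int_equiv x y \<Longrightarrow> int_equiv (- x) (- y)"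
  using int_equiv_sym[of x y] by (simp add: int_equiv_def)

lemma int_equiv_trans:
  assumes "int_equiv x y" and "int_equiv y z"
  shows "int_equiv x z"
  unfolding int_equiv_def
proof
  fix i
  have "(x $ i - y $ i) + (y $ i - z $ i) \<in> \<int>"
    using assms unfolding int_equiv_def by (metis Ints_add)
  then show "x $ i - z $ i \<in> \<int>"
    by simp
qed

quotient_type 'n torus = "real ^ ('n::finite)" / int_equiv
  morphisms rep_torus torus_proj
  by (intro equivpI reflpI sympI transpI)
     (blast intro: int_equiv_refl int_equiv_sym int_equiv_trans)+

instantiation torus :: (finite) ab_group_add
begin

lift_definition zero_torus :: "'a torus" is "0" .

lift_definition plus_torus :: "'a torus \<Rightarrow> 'a torus \<Rightarrow> 'a torus" is "(+)"
  by (rule int_equiv_add)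

lift_definition uminus_torus :: "'a torus \<Rightarrow> 'a torus" is "uminus"
  by (rule int_equiv_uminus)

definition minus_torus :: "'a torus \<Rightarrow> 'a torus \<Rightarrow> 'a torus" where
  "minus_torus x y = x + (- y)"

instance
proof
  fix x y z :: "'a torus"
  show "x + y + z = x + (y + z)"
    by transfer (simp add: add.assoc int_equiv_refl)
  show "x + y = y + x"
    by transfer (simp add: add.commute int_equiv_refl)
  show "0 + x = x"
    by transfer (simp add: int_equiv_refl)
  show "- x + x = 0"
    by transfer (simp add: int_equiv_refl)
  show "x - y = x + (- y)"
    by (rule minus_torus_def)
qed

end

lemma torus_proj_eq_iff: "torus_proj x = torus_proj y \<longleftrightarrow> (\<forall>i. x $ i - y $ i \<in> \<int>)"
  by (simp add: torus.abs_eq_iff int_equiv_def)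

lemma torus_proj_add: "torus_proj x + torus_proj y = torus_proj (x + y)"
  by (rule plus_torus.abs_eq)

text \<open>The covering \<open>\<real>\<^sup>s \<times> \<real> \<rightarrow> \<T>\<^sup>s \<times> \<real>\<close> of the cylinder.\<close>

definition cyl_proj :: "(real ^ 'n::finite) \<times> real \<Rightarrow> 'n torus \<times> real" where
  "cyl_proj = map_prod torus_proj id"


section \<open>Classes of differentiability with real exponent\<close>

text \<open>The Hoelder condition is imposed on compact sets only: lifts of torus maps (such as the
  identity) and maps of the cylinder are not globally Hoelder, while for periodic functions the
  local and the global condition coincide.\<close>

definition locally_Hoelder ::
    "real \<Rightarrow> ('a::euclidean_space \<Rightarrow> 'b::real_normed_vector) \<Rightarrow> bool" where
  "locally_Hoelder \<alpha> f \<longleftrightarrow>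
     (\<forall>K. compact K \<longrightarrow>
        (\<exists>C. \<forall>x\<in>K. \<forall>y\<in>K. norm (f x - f y) \<le> C * norm (x - y) powr \<alpha>))"

text \<open>\<open>C_k_alpha k \<alpha> f\<close>: all partial derivatives of \<open>f\<close> up to order \<open>k\<close> exist and are
  continuous, and those of order \<open>k\<close> are locally Hoelder of exponent \<open>\<alpha>\<close> if \<open>\<alpha> > 0\<close>.
  (In the recursive step, the derivatives of order below \<open>k\<close> are differentiable, hence
  continuous.)\<close>

primrec C_k_alpha ::
    "nat \<Rightarrow> real \<Rightarrow> ('a::euclidean_space \<Rightarrow> 'b::real_normed_vector) \<Rightarrow> bool" where
  "C_k_alpha 0 \<alpha> f \<longleftrightarrow> continuous_on UNIV f \<and> (\<alpha> > 0 \<longrightarrow> locally_Hoelder \<alpha> f)"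
| "C_k_alpha (Suc k) \<alpha> f \<longleftrightarrow>
     (\<forall>x. f differentiable (at x)) \<and>
     (\<forall>e\<in>Basis. C_k_alpha k \<alpha> (\<lambda>x. frechet_derivative f (at x) e))"

definition C_class ::
    "real \<Rightarrow> ('a::euclidean_space \<Rightarrow> 'b::real_normed_vector) \<Rightarrow> bool" where
  "C_class r f \<longleftrightarrow> C_k_alpha (nat \<lfloor>r\<rfloor>) (frac r) f"

text \<open>At integer \<open>r\<close> this is \<open>r\<close> times continuous differentiability.  The scale is exceptional there
  for small divisor estimates: the equation \<open>u (\<sigma> + \<Omega>) - u \<sigma> = \<phi> \<sigma>\<close> with \<open>\<phi>\<close> of mean zero and
  class \<open>r\<close> and \<open>\<Omega>\<close> Diophantine of exponent \<open>\<tau> < r\<close> has a solution of class \<open>r - \<tau>\<close> if \<open>r - \<tau>\<close> is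
  not an integer, but in general only of every class below \<open>r - \<tau>\<close> if it is.\<close>

text \<open>Regularity of maps between quotients, by means of a lift to the universal coverings
  \<open>p\<close> and \<open>q\<close>.  The coverings used are \<open>torus_proj\<close>, \<open>cyl_proj\<close> and, for real-valued
  functions, \<open>id\<close>; in the last case the lift is just the periodic function \<open>f \<circ> p\<close>.\<close>

definition C_map ::
    "('a::euclidean_space \<Rightarrow> 'c) \<Rightarrow> ('b::euclidean_space \<Rightarrow> 'd) \<Rightarrow> real \<Rightarrow> ('c \<Rightarrow> 'd) \<Rightarrow> bool" where
  "C_map p q r f \<longleftrightarrow> (\<exists>F. C_class r F \<and> (\<forall>x. f (p x) = q (F x)))"

definition torus_C :: "real \<Rightarrow> ('n::finite torus \<Rightarrow> real) \<Rightarrow> bool" where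
  "torus_C r f \<longleftrightarrow> C_map torus_proj id r f"

definition torus_diffeo :: "real \<Rightarrow> ('n::finite torus \<Rightarrow> 'n torus) \<Rightarrow> bool" where
  "torus_diffeo r f \<longleftrightarrow>
     bij f \<and> C_map torus_proj torus_proj r f \<and> C_map torus_proj torus_proj r (inv f)"

text \<open>For \<open>r < 1\<close> this is a homeomorphism that is locally Hoelder together with its inverse.\<close>

definition cyl_diffeo ::
    "real \<Rightarrow> ('n::finite torus \<times> real \<Rightarrow> 'n torus \<times> real) \<Rightarrow> bool" where
  "cyl_diffeo r f \<longleftrightarrow>
     bij f \<and> C_map cyl_proj cyl_proj r f \<and> C_map cyl_proj cyl_proj r (inv f)"


section \<open>Diophantine vectors\<close>

text \<open>The norm of the integer vector \<open>k\<close> is the sum norm; another norm only changes \<open>\<nu>\<close>.\<close>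

definition Diophantine :: "real \<Rightarrow> real \<Rightarrow> (real ^ 'n) set" where
  "Diophantine \<nu> \<tau> =
     {\<omega>. \<forall>(k :: int ^ 'n) (n :: int). k \<noteq> 0 \<longrightarrow>
        \<bar>(\<Sum>i\<in>UNIV. of_int (k $ i) * \<omega> $ i) - of_int n\<bar>
          \<ge> \<nu> * (\<Sum>i\<in>UNIV. \<bar>of_int (k $ i)\<bar>) powr (- \<tau>)}"

end

theory Submission
  imports Defs
begin

text \<open>
  The base component of \<open>\<psi> \<circ> H = H \<circ> (translation, \<kappa>)\<close> is the hypothesis on \<open>v\<close> and \<open>h\<close>; the fibre
  component reads \<open>a (h \<sigma>) * b \<sigma> = \<kappa> * b (\<sigma> + \<Omega>)\<close>.  Since \<open>a \<circ> h\<close> is continuous without zeros on a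
  connected space, it has a constant sign \<open>s\<close>.  With \<open>b = exp u\<close> and \<open>\<kappa> = s * exp m\<close> the condition becomes
  the linear equation \<open>u (x + \<Omega>) - u x = \<phi> x - m\<close> for \<open>\<phi> = ln \<bar>a \<circ> h\<bar>\<close>, a periodic function of
  class \<open>r\<close>.  On the Fourier side it is solved by dividing: the coefficient of \<open>u\<close> at
  \<open>k \<noteq> 0\<close> is that of \<open>\<phi>\<close> over \<open>exp (2 \<pi> \<i> k \<cdot> \<Omega>) - 1\<close>, and \<open>m\<close> is the mean of \<open>\<phi>\<close>.

  The point is that this costs only \<open>\<tau>\<close> derivatives.  Bounding every divisor by the Diophantine
  condition and every Fourier coefficient on its own would cost as many more as the dimension.
  The argument, due to Ruessmann, uses that small divisors are rare: two vectors \<open>k \<noteq> l\<close> of norm about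
  \<open>N\<close> have \<open>k \<cdot> \<Omega>\<close> and \<open>l \<cdot> \<Omega>\<close> separated modulo 1 by a multiple of \<open>N powr (- \<tau>)\<close>, because the
  Diophantine condition also applies to \<open>k - l\<close>.  The sum of the inverse squares of all divisors with
  \<open>k\<close> in a dyadic block is therefore of the order \<open>N powr (2 * \<tau>)\<close> that the condition allows for a single term
  (\<open>small_divisor_square_sum\<close>).  On the same block the squares of the coefficients of \<open>\<phi>\<close> sum to
  \<open>O (N powr (- 2 * r))\<close>, by Bessel's inequality for differences of translates of the highest
  derivatives (\<open>fourier_block_decay\<close>).  Cauchy--Schwarz multiplies the two bounds: the absolute values
  of the coefficients of \<open>u\<close> sum to \<open>O (N powr (\<tau> - r))\<close> over each block.

  Conversely, a trigonometric series whose blocks decay like \<open>N powr (- \<rho>)\<close> is of class \<open>\<rho>\<close> if \<open>\<rho>\<close> is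
  not an integer, and of every smaller class in any case (\<open>block_series_C_class\<close>): it can be
  differentiated term by term as long as \<open>\<rho>\<close> exceeds 1, and the remaining exponent
  between 0 and 1 is a Hoelder exponent by interpolation between the size and the slope of each block.
  That the series for \<open>u\<close> solves the equation, and not only up to a function with vanishing Fourier
  coefficients, is Stone--Weierstrass on the embedded torus (\<open>null_fourier_imp_0\<close>).

  Finally, Dirichlet's approximation theorem forces \<open>\<tau> \<ge> 1\<close>, hence \<open>r > 1\<close>.  So \<open>h\<close> and its inverse are
  continuously differentiable, and composition with them preserves the classes up to \<open>r\<close>, also those
  with exponent below 1.
\<close>

section \<open>Calculus of the classes of differentiability\<close>

lemma C_k_alpha_SucI:
  assumes "\<And>x. (f has_derivative f' x) (at x)"
    and "\<And>e. e \<in> Basis \<Longrightarrow> C_k_alpha k \<alpha> (\<lambda>x. f' x e)"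
  shows "C_k_alpha (Suc k) \<alpha> f"
proof -
  have "frechet_derivative f (at x) = f' x" for x
    using assms(1) frechet_derivative_at by metis
  then show ?thesis
    using assms by (auto simp: differentiable_def)
qed

lemma C_k_alpha_Suc_has_derivative:
  "C_k_alpha (Suc k) \<alpha> f \<Longrightarrow> (f has_derivative frechet_derivative f (at x)) (at x)"
  by (simp add: frechet_derivative_works)

lemma C_k_alpha_continuous: "C_k_alpha k \<alpha> f \<Longrightarrow> continuous_on UNIV f"
proof (cases k)
  case (Suc m)
  assume "C_k_alpha k \<alpha> f"
  with Suc show ?thesis
    by (simp add: continuous_at_imp_continuous_on differentiable_imp_continuous_within)
qed simp

lemma locally_HoelderE:
  assumes "locally_Hoelder \<alpha> f" "compact K"
  obtains C where "C \<ge> 0"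
    "\<And>x y. x \<in> K \<Longrightarrow> y \<in> K \<Longrightarrow> norm (f x - f y) \<le> C * norm (x - y) powr \<alpha>"
proof -
  obtain C where C: "\<forall>x\<in>K. \<forall>y\<in>K. norm (f x - f y) \<le> C * norm (x - y) powr \<alpha>"
    using assms by (auto simp: locally_Hoelder_def)
  have "norm (f x - f y) \<le> \<bar>C\<bar> * norm (x - y) powr \<alpha>" if "x \<in> K" "y \<in> K" for x y
  proof -
    have "norm (f x - f y) \<le> C * norm (x - y) powr \<alpha>" using C that by blast
    also have "\<dots> \<le> \<bar>C\<bar> * norm (x - y) powr \<alpha>" by (intro mult_right_mono) auto
    finally show ?thesis .
  qed
  then show thesis using that[of "\<bar>C\<bar>"] by auto
qed

lemma locally_Hoelder_mono:
  fixes f :: "'a::euclidean_space \<Rightarrow> 'b::real_normed_vector"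
  assumes "locally_Hoelder \<alpha> f" "\<beta> \<le> \<alpha>"
  shows "locally_Hoelder \<beta> f"
  unfolding locally_Hoelder_def
proof (intro allI impI)
  fix K :: "'a set" assume K: "compact K"
  obtain C where C: "C \<ge> 0" "\<And>x y. x \<in> K \<Longrightarrow> y \<in> K \<Longrightarrow> norm (f x - f y) \<le> C * norm (x - y) powr \<alpha>"
    using locally_HoelderE[OF assms(1) K] by metis
  obtain D where D: "D > 0" "\<And>x. x \<in> K \<Longrightarrow> norm x \<le> D"
    using compact_imp_bounded[OF K] bounded_pos by metis
  have "norm (f x - f y) \<le> (C * (2 * D) powr (\<alpha> - \<beta>)) * norm (x - y) powr \<beta>" if "x \<in> K" "y \<in> K" for x y
  proof -
    have "norm (x - y) \<le> 2 * D"
      using norm_triangle_ineq4[of x y] D(2)[OF that(1)] D(2)[OF that(2)] by linarith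
    then have "norm (x - y) powr (\<alpha> - \<beta>) \<le> (2 * D) powr (\<alpha> - \<beta>)"
      using assms(2) by (intro powr_mono2) auto
    moreover have "norm (x - y) powr \<alpha> = norm (x - y) powr (\<alpha> - \<beta>) * norm (x - y) powr \<beta>"
      by (simp flip: powr_add)
    ultimately have "norm (x - y) powr \<alpha> \<le> (2 * D) powr (\<alpha> - \<beta>) * norm (x - y) powr \<beta>"
      by (simp add: mult_right_mono)
    then have "C * norm (x - y) powr \<alpha> \<le> C * ((2 * D) powr (\<alpha> - \<beta>) * norm (x - y) powr \<beta>)"
      using C(1) by (rule mult_left_mono)
    then show ?thesis using C(2)[OF that] by simp
  qed
  then show "\<exists>C. \<forall>x\<in>K. \<forall>y\<in>K. norm (f x - f y) \<le> C * norm (x - y) powr \<beta>" by blast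
qed

text \<open>The mean value inequality on the convex hull of \<open>K\<close>, which is again compact, so that the
  continuous partial derivatives are bounded there.\<close>

lemma C_1_lipschitz_on_compact:
  fixes f :: "'a::euclidean_space \<Rightarrow> 'b::real_normed_vector"
  assumes f: "C_k_alpha 1 \<alpha> f" and K: "compact K"
  obtains C where "C \<ge> 0" "\<And>x y. x \<in> K \<Longrightarrow> y \<in> K \<Longrightarrow> norm (f x - f y) \<le> C * norm (x - y)"
proof -
  define f' where "f' x = frechet_derivative f (at x)" for x
  have der: "(f has_derivative f' x) (at x)" for x
    using f C_k_alpha_Suc_has_derivative[of 0] by (simp add: f'_def)
  have cont: "continuous_on UNIV (\<lambda>x. f' x e)" if "e \<in> Basis" for e
    using f that unfolding f'_def by simp
  define S where "S = convex hull K"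
  have S: "compact S" "convex S" "K \<subseteq> S"
    using K by (auto simp: S_def compact_convex_hull hull_subset)
  have "bounded ((\<lambda>x. \<Sum>e\<in>Basis. norm (f' x e)) ` S)"
    using cont continuous_on_subset
    by (intro compact_imp_bounded compact_continuous_image continuous_intros S) blast
  then obtain C where C: "\<And>x. x \<in> S \<Longrightarrow> (\<Sum>e\<in>Basis. norm (f' x e)) \<le> C"
    unfolding bounded_iff by (metis abs_le_D1 image_eqI real_norm_def)
  have on: "onorm (f' x) \<le> max C 0" if "x \<in> S" for x
  proof (rule onorm_le)
    fix v
    interpret f': bounded_linear "f' x" using der has_derivative_bounded_linear by blast
    have "f' x v = (\<Sum>e\<in>Basis. (v \<bullet> e) *\<^sub>R f' x e)"
      using f'.sum[of "\<lambda>e. (v \<bullet> e) *\<^sub>R e" Basis] by (simp add: euclidean_representation f'.scaleR)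
    also have "norm \<dots> \<le> (\<Sum>e\<in>Basis. \<bar>v \<bullet> e\<bar> * norm (f' x e))"
      by (rule order_trans[OF norm_sum]) simp
    also have "\<dots> \<le> (\<Sum>e\<in>Basis. norm v * norm (f' x e))"
      by (intro sum_mono mult_right_mono Basis_le_norm) auto
    also have "\<dots> \<le> norm v * max C 0"
      using C[OF that] by (simp flip: sum_distrib_left add: mult_left_mono)
    finally show "norm (f' x v) \<le> max C 0 * norm v" by (simp add: mult.commute)
  qed
  have "norm (f x - f y) \<le> max C 0 * norm (x - y)" if "x \<in> K" "y \<in> K" for x y
    using differentiable_bound[OF S(2) has_derivative_at_withinI[OF der] on] S(3) that by auto
  then show thesis using that[of "max C 0"] by auto
qed

lemma C_1_locally_Hoelder:
  assumes "C_k_alpha 1 \<alpha> f" "\<beta> \<le> 1"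
  shows "locally_Hoelder \<beta> f"
proof -
  have "locally_Hoelder 1 f"
    unfolding locally_Hoelder_def
    by (intro allI impI, erule C_1_lipschitz_on_compact[OF assms(1)]) auto
  then show ?thesis using assms(2) locally_Hoelder_mono by blast
qed

lemma C_k_alpha_mono_exponent:
  "C_k_alpha k \<alpha> f \<Longrightarrow> \<beta> \<le> \<alpha> \<Longrightarrow> C_k_alpha k \<beta> f"
  by (induction k arbitrary: f) (auto intro: locally_Hoelder_mono)

text \<open>The case \<open>k = 0\<close> is the local Lipschitz continuity of continuously differentiable functions.\<close>

lemma C_k_alpha_Suc_imp:
  assumes "C_k_alpha (Suc k) \<alpha> f" "\<beta> \<le> 1"
  shows "C_k_alpha k \<beta> f"
  using assms
proof (induction k arbitrary: f)
  case 0
  then show ?case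
    using C_1_locally_Hoelder[of \<alpha> f \<beta>] C_k_alpha_continuous[of "Suc 0" \<alpha> f] by simp
next
  case (Suc k)
  then show ?case by simp
qed

lemma C_k_alpha_less_imp:
  assumes "C_k_alpha m \<alpha> f" "k < m" "\<alpha> \<le> 1" "\<beta> \<le> 1"
  shows "C_k_alpha k \<beta> f"
  using assms(2,1)
proof (induction m arbitrary: f)
  case (Suc m)
  then show ?case
    using C_k_alpha_Suc_imp[of m \<alpha> f \<alpha>] C_k_alpha_Suc_imp[of m \<alpha> f \<beta>] assms(3,4)
    by (cases "k = m") auto
qed simp

lemma C_class_mono:
  assumes "C_class r f" "\<rho> \<le> r" "0 \<le> \<rho>"
  shows "C_class \<rho> f"
proof (cases "\<lfloor>\<rho>\<rfloor> = \<lfloor>r\<rfloor>")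
  case True
  then have "frac \<rho> \<le> frac r" using assms(2) by (simp add: frac_def)
  then show ?thesis using assms(1) True C_k_alpha_mono_exponent unfolding C_class_def by metis
next
  case False
  then have "nat \<lfloor>\<rho>\<rfloor> < nat \<lfloor>r\<rfloor>"
    using floor_mono[OF assms(2)] assms(3)
    by (metis nat_less_eq_zless order_le_less zero_le_floor)
  then show ?thesis
    using assms(1) C_k_alpha_less_imp frac_lt_1 less_imp_le unfolding C_class_def by metis
qed

lemma C_k_alpha_const: "C_k_alpha k \<alpha> (\<lambda>x. c)"
proof (induction k arbitrary: c)
  case 0
  show ?case by (auto simp: locally_Hoelder_def intro: exI[of _ 0])
next
  case (Suc k)
  show ?case by (rule C_k_alpha_SucI[where f' = "\<lambda>_ _. 0"]) (auto intro: Suc)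
qed

text \<open>The derivative is constant, so a linear map has one derivative more than claimed.\<close>

lemma C_k_alpha_bounded_linear:
  assumes "bounded_linear L" "\<alpha> \<le> 1"
  shows "C_k_alpha k \<alpha> L"
proof -
  have "C_k_alpha (Suc k) \<alpha> L"
    using assms by (intro C_k_alpha_SucI[where f' = "\<lambda>_. L"] bounded_linear_imp_has_derivative)
      (auto intro: C_k_alpha_const)
  then show ?thesis using assms(2) by (rule C_k_alpha_Suc_imp)
qed

lemma C_k_alpha_add:
  assumes "C_k_alpha k \<alpha> f" "C_k_alpha k \<alpha> g"
  shows "C_k_alpha k \<alpha> (\<lambda>x. f x + g x)"
  using assms
proof (induction k arbitrary: f g)
  case 0
  have "locally_Hoelder \<alpha> (\<lambda>x. f x + g x)" if H: "locally_Hoelder \<alpha> f" "locally_Hoelder \<alpha> g"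
    unfolding locally_Hoelder_def
  proof (intro allI impI)
    fix K :: "'a set" assume K: "compact K"
    obtain C where C: "C \<ge> 0" "\<And>x y. x \<in> K \<Longrightarrow> y \<in> K \<Longrightarrow> norm (f x - f y) \<le> C * norm (x - y) powr \<alpha>"
      using locally_HoelderE[OF H(1) K] by metis
    obtain D where D: "D \<ge> 0" "\<And>x y. x \<in> K \<Longrightarrow> y \<in> K \<Longrightarrow> norm (g x - g y) \<le> D * norm (x - y) powr \<alpha>"
      using locally_HoelderE[OF H(2) K] by metis
    have "norm ((f x + g x) - (f y + g y)) \<le> (C + D) * norm (x - y) powr \<alpha>" if "x \<in> K" "y \<in> K" for x y
      using norm_diff_triangle_ineq[of "f x" "g x" "f y" "g y"] C(2)[OF that] D(2)[OF that]
      by (simp add: algebra_simps)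
    then show "\<exists>C. \<forall>x\<in>K. \<forall>y\<in>K. norm ((f x + g x) - (f y + g y)) \<le> C * norm (x - y) powr \<alpha>" by blast
  qed
  then show ?case using 0 by (auto intro: continuous_intros)
next
  case (Suc k)
  show ?case
    by (rule C_k_alpha_SucI, rule has_derivative_add[OF C_k_alpha_Suc_has_derivative[OF Suc.prems(1)]
        C_k_alpha_Suc_has_derivative[OF Suc.prems(2)]]) (use Suc in auto)
qed

lemma C_k_alpha_sum:
  assumes "finite I" "\<And>i. i \<in> I \<Longrightarrow> C_k_alpha k \<alpha> (f i)"
  shows "C_k_alpha k \<alpha> (\<lambda>x. \<Sum>i\<in>I. f i x)"
  using assms by (induction I rule: finite_induct) (auto intro: C_k_alpha_const C_k_alpha_add)

lemma C_k_alpha_compose_linear: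
  fixes f :: "'a::euclidean_space \<Rightarrow> 'b::real_normed_vector"
  assumes L: "bounded_linear L" and "C_k_alpha k \<alpha> f"
  shows "C_k_alpha k \<alpha> (\<lambda>x. L (f x))"
  using assms(2)
proof (induction k arbitrary: f)
  case 0
  have "locally_Hoelder \<alpha> (\<lambda>x. L (f x))" if H: "locally_Hoelder \<alpha> f"
    unfolding locally_Hoelder_def
  proof (intro allI impI)
    fix K :: "'a set" assume K: "compact K"
    obtain C where C: "C \<ge> 0" "\<And>x y. x \<in> K \<Longrightarrow> y \<in> K \<Longrightarrow> norm (f x - f y) \<le> C * norm (x - y) powr \<alpha>"
      using locally_HoelderE[OF H K] by metis
    have "norm (L (f x) - L (f y)) \<le> onorm L * C * norm (x - y) powr \<alpha>" if "x \<in> K" "y \<in> K" for x y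
    proof -
      have "norm (L (f x) - L (f y)) = norm (L (f x - f y))"
        using L by (simp add: linear_diff bounded_linear.linear)
      also have "\<dots> \<le> onorm L * norm (f x - f y)" using L by (rule onorm)
      also have "\<dots> \<le> onorm L * (C * norm (x - y) powr \<alpha>)"
        using C(2)[OF that] L by (intro mult_left_mono) (auto simp: onorm_pos_le)
      finally show ?thesis by (simp add: mult.assoc)
    qed
    then show "\<exists>C. \<forall>x\<in>K. \<forall>y\<in>K. norm (L (f x) - L (f y)) \<le> C * norm (x - y) powr \<alpha>" by blast
  qed
  then show ?case using 0 L by (auto intro: bounded_linear.continuous_on)
next
  case (Suc k)
  show ?case
    by (rule C_k_alpha_SucI, rule bounded_linear.has_derivative[OF L C_k_alpha_Suc_has_derivative[OF Suc.prems]])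
      (use Suc in auto)
qed

lemma C_k_alpha_scaleR:
  fixes f :: "'a::euclidean_space \<Rightarrow> real"
  assumes "C_k_alpha k \<alpha> f" "C_k_alpha k \<alpha> g" "\<alpha> \<le> 1"
  shows "C_k_alpha k \<alpha> (\<lambda>x. f x *\<^sub>R g x)"
  using assms(1,2)
proof (induction k arbitrary: f g)
  case 0
  have "locally_Hoelder \<alpha> (\<lambda>x. f x *\<^sub>R g x)" if H: "locally_Hoelder \<alpha> f" "locally_Hoelder \<alpha> g"
    unfolding locally_Hoelder_def
  proof (intro allI impI)
    fix K :: "'a set" assume K: "compact K"
    obtain C where C: "C \<ge> 0" "\<And>x y. x \<in> K \<Longrightarrow> y \<in> K \<Longrightarrow> norm (f x - f y) \<le> C * norm (x - y) powr \<alpha>"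
      using locally_HoelderE[OF H(1) K] by metis
    obtain D where D: "D \<ge> 0" "\<And>x y. x \<in> K \<Longrightarrow> y \<in> K \<Longrightarrow> norm (g x - g y) \<le> D * norm (x - y) powr \<alpha>"
      using locally_HoelderE[OF H(2) K] by metis
    have "bounded (f ` K)" "bounded (g ` K)"
      using 0 K by (auto intro!: compact_imp_bounded compact_continuous_image intro: continuous_on_subset)
    then obtain M N where M: "\<And>x. x \<in> K \<Longrightarrow> norm (f x) \<le> M" and N: "\<And>x. x \<in> K \<Longrightarrow> norm (g x) \<le> N"
      by (force simp: bounded_iff)
    have "norm (f x *\<^sub>R g x - f y *\<^sub>R g y) \<le> (M * D + C * N) * norm (x - y) powr \<alpha>" if "x \<in> K" "y \<in> K" for x y
    proof -
      have "f x *\<^sub>R g x - f y *\<^sub>R g y = f x *\<^sub>R (g x - g y) + (f x - f y) *\<^sub>R g y"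
        by (simp add: algebra_simps)
      then have "norm (f x *\<^sub>R g x - f y *\<^sub>R g y) \<le> norm (f x) * norm (g x - g y) + norm (f x - f y) * norm (g y)"
        using norm_triangle_ineq by (metis norm_scaleR real_norm_def)
      also have "\<dots> \<le> M * (D * norm (x - y) powr \<alpha>) + (C * norm (x - y) powr \<alpha>) * N"
        using M[OF that(1)] N[OF that(2)] C(2)[OF that] D(2)[OF that]
        by (intro add_mono mult_mono') auto
      finally show ?thesis by (simp add: algebra_simps)
    qed
    then show "\<exists>C. \<forall>x\<in>K. \<forall>y\<in>K. norm (f x *\<^sub>R g x - f y *\<^sub>R g y) \<le> C * norm (x - y) powr \<alpha>" by blast
  qed
  then show ?case using 0 by (auto intro: continuous_intros)
next
  case (Suc k)
  have lower: "C_k_alpha k \<alpha> f" "C_k_alpha k \<alpha> g"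
    using Suc.prems assms(3) by (blast intro: C_k_alpha_Suc_imp)+
  show ?case
    by (rule C_k_alpha_SucI, rule has_derivative_scaleR[OF C_k_alpha_Suc_has_derivative[OF Suc.prems(1)]
        C_k_alpha_Suc_has_derivative[OF Suc.prems(2)]]) (use Suc lower in \<open>auto intro!: C_k_alpha_add\<close>)
qed

text \<open>The condition \<open>C_k_alpha 1 0 g\<close> makes \<open>g\<close> locally Lipschitz, so that the exponent \<open>\<alpha>\<close> of \<open>f\<close>
  survives in the case \<open>k = 0\<close>.  In the induction step, the chain rule writes a partial derivative
  of the composite as a sum of products of partial derivatives of \<open>g\<close> with partial derivatives of \<open>f\<close>
  composed with \<open>g\<close>.\<close>

lemma C_k_alpha_compose:
  fixes f :: "'b::euclidean_space \<Rightarrow> 'c::real_normed_vector" and g :: "'a::euclidean_space \<Rightarrow> 'b"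
  assumes "C_k_alpha k \<alpha> f" "C_k_alpha k \<alpha> g" "C_k_alpha 1 0 g" "0 \<le> \<alpha>" "\<alpha> \<le> 1"
  shows "C_k_alpha k \<alpha> (\<lambda>x. f (g x))"
  using assms(1-2)
proof (induction k arbitrary: f)
  case 0
  have cg: "continuous_on UNIV g" using assms(3) C_k_alpha_continuous by blast
  have "locally_Hoelder \<alpha> (\<lambda>x. f (g x))" if H: "locally_Hoelder \<alpha> f"
    unfolding locally_Hoelder_def
  proof (intro allI impI)
    fix K :: "'a set" assume K: "compact K"
    have gK: "compact (g ` K)" using K cg by (auto intro: compact_continuous_image continuous_on_subset)
    obtain C where C: "C \<ge> 0" "\<And>x y. x \<in> g ` K \<Longrightarrow> y \<in> g ` K \<Longrightarrow> norm (f x - f y) \<le> C * norm (x - y) powr \<alpha>"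
      using locally_HoelderE[OF H gK] by metis
    obtain D where D: "D \<ge> 0" "\<And>x y. x \<in> K \<Longrightarrow> y \<in> K \<Longrightarrow> norm (g x - g y) \<le> D * norm (x - y)"
      using C_1_lipschitz_on_compact[OF assms(3) K] by metis
    have "norm (f (g x) - f (g y)) \<le> C * D powr \<alpha> * norm (x - y) powr \<alpha>" if "x \<in> K" "y \<in> K" for x y
    proof -
      have "norm (g x - g y) powr \<alpha> \<le> (D * norm (x - y)) powr \<alpha>"
        using D(2)[OF that] assms(4) by (intro powr_mono2) auto
      then have "C * norm (g x - g y) powr \<alpha> \<le> C * (D * norm (x - y)) powr \<alpha>"
        using C(1) by (rule mult_left_mono)
      then show ?thesis using C(2)[of "g x" "g y"] that D(1) by (simp add: powr_mult mult.assoc)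
    qed
    then show "\<exists>C. \<forall>x\<in>K. \<forall>y\<in>K. norm (f (g x) - f (g y)) \<le> C * norm (x - y) powr \<alpha>" by blast
  qed
  then show ?case using 0 cg by (auto intro: continuous_on_compose2)
next
  case (Suc k)
  define f' where "f' x = frechet_derivative f (at x)" for x
  define g' where "g' x = frechet_derivative g (at x)" for x
  have f': "(f has_derivative f' x) (at x)" for x
    using Suc.prems unfolding f'_def by (intro C_k_alpha_Suc_has_derivative)
  have g': "(g has_derivative g' x) (at x)" for x
    using Suc.prems unfolding g'_def by (intro C_k_alpha_Suc_has_derivative)
  have expand: "f' (g x) (g' x e) = (\<Sum>b\<in>Basis. (g' x e \<bullet> b) *\<^sub>R f' (g x) b)" for x e
  proof -
    interpret f': bounded_linear "f' (g x)" using f' has_derivative_bounded_linear by blast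
    show ?thesis
      using f'.sum[of "\<lambda>b. (g' x e \<bullet> b) *\<^sub>R b" Basis] by (simp add: euclidean_representation f'.scaleR)
  qed
  have "C_k_alpha k \<alpha> g" using Suc.prems assms(5) by (blast intro: C_k_alpha_Suc_imp)
  then have f'C: "C_k_alpha k \<alpha> (\<lambda>x. f' (g x) b)" if "b \<in> Basis" for b
    using Suc.IH[of "\<lambda>y. f' y b"] Suc.prems(1) that by (simp add: f'_def)
  show ?case
  proof (rule C_k_alpha_SucI)
    show "((\<lambda>x. f (g x)) has_derivative (\<lambda>e. f' (g x) (g' x e))) (at x)" for x
      by (rule has_derivative_compose[OF g' f'])
    fix e :: 'a assume "e \<in> Basis"
    then have g'C: "C_k_alpha k \<alpha> (\<lambda>x. g' x e)" using Suc.prems(2) by (simp add: g'_def)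
    show "C_k_alpha k \<alpha> (\<lambda>x. f' (g x) (g' x e))"
      unfolding expand
      by (intro C_k_alpha_sum C_k_alpha_scaleR C_k_alpha_compose_linear[OF bounded_linear_inner_left] g'C f'C
          finite_Basis assms(5))
  qed
qed

text \<open>Here \<open>G 0\<close> is the outer function and \<open>G j\<close> its \<open>j\<close>th derivative.  Quantifying over \<open>j\<close> makes the
  induction on \<open>k\<close> self-contained, since differentiating \<open>G j \<circ> f\<close> produces \<open>G (Suc j) \<circ> f\<close>.\<close>

lemma C_k_alpha_compose_smooth:
  fixes f :: "'a::euclidean_space \<Rightarrow> real" and G :: "nat \<Rightarrow> real \<Rightarrow> real"
  assumes "C_k_alpha k \<alpha> f" "\<And>x. f x \<in> S" "convex S"
    and G: "\<And>j x. x \<in> S \<Longrightarrow> (G j has_real_derivative G (Suc j) x) (at x)"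
    and \<alpha>: "0 \<le> \<alpha>" "\<alpha> \<le> 1"
  shows "C_k_alpha k \<alpha> (\<lambda>x. G j (f x))"
  using assms(1)
proof (induction k arbitrary: j)
  case 0
  have Gc: "continuous_on S (G i)" for i
    using G by (auto intro!: continuous_at_imp_continuous_on DERIV_isCont)
  have "locally_Hoelder \<alpha> (\<lambda>x. G j (f x))" if H: "locally_Hoelder \<alpha> f"
    unfolding locally_Hoelder_def
  proof (intro allI impI)
    fix K :: "'a set" assume K: "compact K"
    \<comment> \<open>The mean value inequality needs a convex set, on which \<open>G (Suc j)\<close> is still bounded.\<close>
    define T where "T = convex hull (f ` K)"
    have T: "compact T" "convex T" "f ` K \<subseteq> T"
      unfolding T_def using K 0
      by (auto intro!: compact_convex_hull compact_continuous_image intro: continuous_on_subset hull_subset[THEN subsetD])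
    have TS: "T \<subseteq> S" unfolding T_def using assms(2,3) by (intro hull_minimal) auto
    have "bounded (G (Suc j) ` T)"
      using T(1) Gc TS by (auto intro!: compact_imp_bounded compact_continuous_image intro: continuous_on_subset)
    then obtain M where M: "\<And>x. x \<in> T \<Longrightarrow> \<bar>G (Suc j) x\<bar> \<le> M"
      by (force simp: bounded_iff)
    obtain C where C: "C \<ge> 0" "\<And>x y. x \<in> K \<Longrightarrow> y \<in> K \<Longrightarrow> norm (f x - f y) \<le> C * norm (x - y) powr \<alpha>"
      using locally_HoelderE[OF H K] by metis
    have "norm (G j (f x) - G j (f y)) \<le> M * C * norm (x - y) powr \<alpha>" if "x \<in> K" "y \<in> K" for x y
    proof -
      have fT: "f x \<in> T" "f y \<in> T" using that T(3) by auto
      have "(G j has_field_derivative G (Suc j) z) (at z within T)" if "z \<in> T" for z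
        using G TS that has_field_derivative_at_within by blast
      then have "norm (G j (f x) - G j (f y)) \<le> M * norm (f x - f y)"
        using field_differentiable_bound[OF T(2), of "G j" "G (Suc j)" M "f x" "f y"] fT M by auto
      also have "\<dots> \<le> M * (C * norm (x - y) powr \<alpha>)"
        using C(2)[OF that] M[OF fT(1)] by (intro mult_left_mono) auto
      finally show ?thesis by (simp add: mult.assoc)
    qed
    then show "\<exists>C. \<forall>x\<in>K. \<forall>y\<in>K. norm (G j (f x) - G j (f y)) \<le> C * norm (x - y) powr \<alpha>" by blast
  qed
  moreover have "continuous_on UNIV (\<lambda>x. G j (f x))"
    using 0 assms(2) by (intro continuous_on_compose2[OF Gc]) auto
  ultimately show ?case using 0 by auto
next
  case (Suc k)
  have "C_k_alpha k \<alpha> f" using Suc.prems \<alpha>(2) by (rule C_k_alpha_Suc_imp)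
  then have IH: "C_k_alpha k \<alpha> (\<lambda>x. G (Suc j) (f x))" by (rule Suc.IH)
  show ?case
  proof (rule C_k_alpha_SucI)
    fix x
    show "((\<lambda>x. G j (f x)) has_derivative (\<lambda>e. G (Suc j) (f x) *\<^sub>R frechet_derivative f (at x) e)) (at x)"
      using has_derivative_compose[OF C_k_alpha_Suc_has_derivative[OF Suc.prems]
          G[OF assms(2), unfolded has_field_derivative_def]] by simp
  next
    fix e :: 'a assume "e \<in> Basis"
    then show "C_k_alpha k \<alpha> (\<lambda>x. G (Suc j) (f x) *\<^sub>R frechet_derivative f (at x) e)"
      using Suc.prems by (intro C_k_alpha_scaleR IH \<alpha>) auto
  qed
qed

section \<open>Periodic functions, characters and the mean over the torus\<close>

definition periodic :: "(real ^ 'n::finite \<Rightarrow> 'b) \<Rightarrow> bool" where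
  "periodic f \<longleftrightarrow> (\<forall>x y. torus_proj x = torus_proj y \<longrightarrow> f x = f y)"

lemma periodic_add_axis:
  assumes "periodic f" shows "f (x + axis i 1) = f x"
proof -
  have "torus_proj (x + axis i 1) = torus_proj x"
    by (auto simp: torus_proj_eq_iff axis_def)
  then show ?thesis using assms unfolding periodic_def by blast
qed

lemma periodic_compose2: "periodic f \<Longrightarrow> periodic g \<Longrightarrow> periodic (\<lambda>x. h (f x) (g x))"
  unfolding periodic_def by metis

lemma periodic_compose: "periodic f \<Longrightarrow> periodic (\<lambda>x. h (f x))"
  unfolding periodic_def by metis

definition int_pairing :: "int ^ 'n::finite \<Rightarrow> real ^ 'n \<Rightarrow> real" where
  "int_pairing k x = (\<Sum>i\<in>UNIV. of_int (k $ i) * x $ i)"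

definition character :: "int ^ 'n::finite \<Rightarrow> real ^ 'n \<Rightarrow> complex" where
  "character k x = cis (2 * pi * int_pairing k x)"

lemma bounded_linear_int_pairing: "bounded_linear (int_pairing k)"
  unfolding int_pairing_def[abs_def]
  by (intro bounded_linear_sum bounded_linear_const_mult bounded_linear_vec_nth)

lemma int_pairing_axis: "int_pairing k (t *\<^sub>R axis i 1) = of_int (k $ i) * t"
proof -
  have "int_pairing k (t *\<^sub>R axis i 1) = (\<Sum>j\<in>UNIV. if j = i then of_int (k $ i) * t else 0)"
    unfolding int_pairing_def by (intro sum.cong) (auto simp: axis_def)
  then show ?thesis by simp
qed

lemma int_pairing_diff_left: "int_pairing (k - l) x = int_pairing k x - int_pairing l x"
  by (simp add: int_pairing_def left_diff_distrib sum_subtractf)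

lemma int_pairing_add_left: "int_pairing (k + l) x = int_pairing k x + int_pairing l x"
  by (simp add: int_pairing_def distrib_right sum.distrib)

lemma int_pairing_minus_left: "int_pairing (- k) x = - int_pairing k x"
  by (simp add: int_pairing_def sum_negf)

lemma int_pairing_add: "int_pairing k (x + y) = int_pairing k x + int_pairing k y"
  by (simp add: int_pairing_def distrib_left sum.distrib)

lemma character_0 [simp]: "character 0 x = 1"
  by (simp add: character_def int_pairing_def)

lemma norm_character [simp]: "norm (character k x) = 1"
  by (simp add: character_def)

lemma character_mult: "character k x * character l x = character (k + l) x"
  by (simp add: character_def cis_mult int_pairing_add_left algebra_simps)

lemma character_add: "character k (x + y) = character k x * character k y"
  by (simp add: character_def cis_mult int_pairing_add algebra_simps)

lemma cnj_character: "cnj (character k x) = character (- k) x"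
  by (simp add: character_def cis_cnj int_pairing_minus_left)

lemma character_minus_mult [simp]: "character k x * character (- k) x = 1"
  by (simp add: character_mult)

lemma continuous_on_character [continuous_intros]: "continuous_on S (character k)"
  unfolding character_def[abs_def]
  by (intro continuous_intros bounded_linear.continuous_on[OF bounded_linear_int_pairing])

lemma periodic_character: "periodic (character k)"
  unfolding periodic_def
proof (intro allI impI)
  fix x y :: "real ^ 'a" assume "torus_proj x = torus_proj y"
  then have "int_pairing k (x - y) \<in> \<int>"
    unfolding int_pairing_def torus_proj_eq_iff by (intro Ints_sum Ints_mult) auto
  then have "character k (x - y) = 1" by (simp add: character_def cis_multiple_2pi)
  then show "character k x = character k y" using character_add[of k "x - y" y] by simp
qed

definition torus_mean :: "(real ^ 'n::finite \<Rightarrow> complex) \<Rightarrow> complex" where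
  "torus_mean f = integral (cbox 0 1) f"

lemma measure_unit_cube: "measure lborel (cbox 0 (1 :: real ^ 'n::finite)) = 1"
  by (simp add: content_cbox_if_cart interval_ne_empty_cart)

lemma integrable_on_cbox_if_continuous:
  fixes f :: "'a::euclidean_space \<Rightarrow> 'b::banach"
  shows "continuous_on UNIV f \<Longrightarrow> f integrable_on cbox a b"
  by (intro integrable_continuous) (blast intro: continuous_on_subset)

lemma torus_mean_add:
  "continuous_on UNIV f \<Longrightarrow> continuous_on UNIV g \<Longrightarrow>
    torus_mean (\<lambda>x. f x + g x) = torus_mean f + torus_mean g"
  unfolding torus_mean_def by (intro integral_add integrable_on_cbox_if_continuous)

lemma torus_mean_diff:
  "continuous_on UNIV f \<Longrightarrow> continuous_on UNIV g \<Longrightarrow>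
    torus_mean (\<lambda>x. f x - g x) = torus_mean f - torus_mean g"
  unfolding torus_mean_def by (intro integral_diff integrable_on_cbox_if_continuous)

lemma torus_mean_mult_left: "torus_mean (\<lambda>x. c * f x) = c * torus_mean f"
  unfolding torus_mean_def by simp

lemma torus_mean_const: "torus_mean (\<lambda>x. c) = c"
  unfolding torus_mean_def by (simp add: measure_unit_cube)

lemma torus_mean_cnj: "torus_mean (\<lambda>x. cnj (f x)) = cnj (torus_mean f)"
  unfolding torus_mean_def by (simp add: integral_cnj)

lemma norm_torus_mean_le:
  assumes "continuous_on UNIV f" "\<And>x. x \<in> cbox 0 1 \<Longrightarrow> norm (f x) \<le> M"
  shows "norm (torus_mean f) \<le> M"
proof -
  have "norm (torus_mean f) \<le> integral (cbox 0 (1 :: real ^ 'a)) (\<lambda>_. M)"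
    unfolding torus_mean_def using assms
    by (intro integral_norm_bound_integral integrable_on_cbox_if_continuous) auto
  then show ?thesis by (simp add: measure_unit_cube)
qed

lemma Re_torus_mean:
  "continuous_on UNIV f \<Longrightarrow> Re (torus_mean f) = integral (cbox 0 1) (\<lambda>x. Re (f x))"
  unfolding torus_mean_def
  using integral_linear[OF integrable_on_cbox_if_continuous bounded_linear_Re, of f 0 1] by (simp add: o_def)

text \<open>The unit cube and its translate along the axis share a slab; by periodicity, the slab that the
  translate gains at one end has the same integral as the slab that it loses at the other end.\<close>

lemma torus_mean_translate_axis:
  assumes f: "continuous_on UNIV f" "periodic f" and t: "0 \<le> t" "t \<le> 1"
  shows "torus_mean (\<lambda>x. f (x + t *\<^sub>R axis i 1)) = torus_mean f"
proof -
  define e :: "real ^ 'a" where "e = axis i 1"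
  have e: "e \<in> Basis" "x \<bullet> e = x $ i" "e $ j = (if j = i then 1 else 0)" for x j
    unfolding e_def by (simp_all add: axis_in_Basis_iff inner_axis) (simp add: axis_def)
  let ?Q = "cbox 0 (1 :: real ^ 'a)" and ?T = "cbox (t *\<^sub>R e) (1 + t *\<^sub>R e)"
  \<comment> \<open>All boxes in the decomposition are of this form.\<close>
  have box: "cbox (s *\<^sub>R e) (1 + u *\<^sub>R e)
      = {x. s \<le> x $ i \<and> x $ i \<le> 1 + u \<and> (\<forall>j. j \<noteq> i \<longrightarrow> 0 \<le> x $ j \<and> x $ j \<le> 1)}" for s u
  proof -
    have "x \<in> cbox (s *\<^sub>R e) (1 + u *\<^sub>R e) \<longleftrightarrow>
        (\<forall>j. (j = i \<longrightarrow> s \<le> x $ j \<and> x $ j \<le> 1 + u) \<and> (j \<noteq> i \<longrightarrow> 0 \<le> x $ j \<and> x $ j \<le> 1))" for x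
      unfolding mem_box_cart by (intro all_cong1) (simp add: e)
    then show ?thesis by blast
  qed
  have sets: "?Q \<inter> {x. x \<bullet> e \<le> t} = cbox 0 (1 + t *\<^sub>R e - e)"
    "?Q \<inter> {x. x \<bullet> e \<ge> t} = cbox (t *\<^sub>R e) 1"
    "?T \<inter> {x. x \<bullet> e \<le> 1} = cbox (t *\<^sub>R e) 1"
    "?T \<inter> {x. x \<bullet> e \<ge> 1} = cbox e (1 + t *\<^sub>R e)"
    using t box[of 0 0] box[of 0 "t - 1"] box[of t 0] box[of t t] box[of 1 t]
    by (auto simp: e scaleR_diff_left add_diff_eq)
  have "torus_mean (\<lambda>x. f (x + t *\<^sub>R e)) = integral ?T f"
    using integral_shift_cbox[of "t *\<^sub>R e" "t *\<^sub>R e" "1 + t *\<^sub>R e" f] by (simp add: torus_mean_def)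
  also have "\<dots> = integral (cbox (t *\<^sub>R e) 1) f + integral (cbox e (1 + t *\<^sub>R e)) f"
    using integral_split[OF integrable_on_cbox_if_continuous[OF f(1)] e(1), of "t *\<^sub>R e" "1 + t *\<^sub>R e" 1]
    unfolding sets .
  also have "integral (cbox e (1 + t *\<^sub>R e)) f = integral (cbox 0 (1 + t *\<^sub>R e - e)) (\<lambda>x. f (x + e))"
    using integral_shift_cbox[of e e "1 + t *\<^sub>R e" f] by simp
  also have "\<dots> = integral (cbox 0 (1 + t *\<^sub>R e - e)) f"
    using periodic_add_axis[OF f(2)] by (simp add: e_def)
  also have "integral (cbox (t *\<^sub>R e) 1) f + \<dots> = torus_mean f"
    using integral_split[OF integrable_on_cbox_if_continuous[OF f(1)] e(1), of 0 1 t]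
    unfolding sets torus_mean_def by simp
  finally show ?thesis by (simp add: e_def)
qed

text \<open>If \<open>k $ i \<noteq> 0\<close>, a translation by half a period along the axis \<open>i\<close> changes the sign of the character
  but not its mean.\<close>

lemma torus_mean_character: "torus_mean (character k) = (if k = 0 then 1 else 0)"
proof (cases "k = 0")
  case True
  then show ?thesis using torus_mean_const[of 1] by (simp add: character_0[abs_def])
next
  case False
  then obtain i where i: "k $ i \<noteq> 0" by (metis vec_eq_iff zero_index)
  define t where "t = 1 / (2 * \<bar>real_of_int (k $ i)\<bar>)"
  have ki: "1 \<le> \<bar>real_of_int (k $ i)\<bar>" using i by linarith
  have t: "0 \<le> t" "t \<le> 1" using ki by (auto simp: t_def field_simps)
  have "2 * pi * (of_int (k $ i) * t) = pi \<or> 2 * pi * (of_int (k $ i) * t) = - pi"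
    using i by (auto simp: t_def field_simps abs_if)
  then have "character k (t *\<^sub>R axis i 1) = - 1"
    unfolding character_def int_pairing_axis complex_eq_iff cis.simps by (elim disjE; simp only:; simp)
  then have "character k (x + t *\<^sub>R axis i 1) = (- 1) * character k x" for x
    by (simp add: character_add)
  then have "torus_mean (character k) = (- 1) * torus_mean (character k)"
    using torus_mean_translate_axis[OF continuous_on_character periodic_character t, of k i]
    by (simp only: torus_mean_mult_left)
  then show ?thesis using False by simp
qed

section \<open>Fourier coefficients\<close>

definition fourier :: "(real ^ 'n::finite \<Rightarrow> complex) \<Rightarrow> int ^ 'n \<Rightarrow> complex" where
  "fourier f k = torus_mean (\<lambda>x. character (- k) x * f x)"

lemma fourier_add:
  "continuous_on UNIV f \<Longrightarrow> continuous_on UNIV g \<Longrightarrow>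
    fourier (\<lambda>x. f x + g x) k = fourier f k + fourier g k"
  unfolding fourier_def distrib_left by (intro torus_mean_add continuous_intros)

lemma fourier_diff:
  "continuous_on UNIV f \<Longrightarrow> continuous_on UNIV g \<Longrightarrow>
    fourier (\<lambda>x. f x - g x) k = fourier f k - fourier g k"
  unfolding fourier_def right_diff_distrib by (intro torus_mean_diff continuous_intros)

lemma fourier_mult_left: "fourier (\<lambda>x. c * f x) k = c * fourier f k"
  unfolding fourier_def mult.left_commute[of _ c] by (rule torus_mean_mult_left)

lemma fourier_mult_character: "fourier (\<lambda>x. character l x * f x) k = fourier f (k - l)"
  unfolding fourier_def by (simp add: character_mult flip: mult.assoc)

lemma fourier_character: "fourier (character l) k = (if k = l then 1 else 0)"
  unfolding fourier_def by (simp add: character_mult torus_mean_character[unfolded fun_eq_iff])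

lemma fourier_translate_axis:
  assumes "continuous_on UNIV f" "periodic f" "0 \<le> t" "t \<le> 1"
  shows "fourier (\<lambda>x. f (x + t *\<^sub>R axis i 1)) k = character k (t *\<^sub>R axis i 1) * fourier f k"
proof -
  let ?y = "t *\<^sub>R axis i 1"
  have "character (- k) x * f (x + ?y) = character k ?y * (character (- k) (x + ?y) * f (x + ?y))" for x
    using character_minus_mult[of k ?y] by (simp add: character_add)
  then have "fourier (\<lambda>x. f (x + ?y)) k
      = character k ?y * torus_mean (\<lambda>x. character (- k) (x + ?y) * f (x + ?y))"
    unfolding fourier_def by (simp only: torus_mean_mult_left)
  also have "torus_mean (\<lambda>x. character (- k) (x + ?y) * f (x + ?y)) = fourier f k"
    unfolding fourier_def using assms
    by (intro torus_mean_translate_axis[where f = "\<lambda>x. character (- k) x * f x"] continuous_intros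
        periodic_compose2[where h = "(*)"] periodic_character)
  finally show ?thesis .
qed

text \<open>Induction on \<open>B\<close>: subtracting from \<open>f\<close> its component along one character lowers the mean square by
  the square of that coefficient and leaves the other coefficients unchanged.\<close>

lemma Bessel:
  assumes "finite B" "continuous_on UNIV f"
  shows "(\<Sum>k\<in>B. (norm (fourier f k))\<^sup>2) \<le> Re (torus_mean (\<lambda>x. f x * cnj (f x)))"
  using assms
proof (induction B arbitrary: f rule: finite_induct)
  case empty
  then have "Re (torus_mean (\<lambda>x. f x * cnj (f x))) = integral (cbox 0 1) (\<lambda>x. Re (f x * cnj (f x)))"
    by (intro Re_torus_mean continuous_intros)
  also have "\<dots> \<ge> 0"
    by (intro integral_nonneg integrable_on_cbox_if_continuous continuous_intros empty) auto
  finally show ?case by simp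
next
  case (insert k B)
  define c where "c = fourier f k"
  define g where "g x = f x - c * character k x" for x
  have g: "continuous_on UNIV g" unfolding g_def by (intro continuous_intros insert)
  have fg: "fourier g l = fourier f l" if "l \<in> B" for l
    using insert(2,4) that unfolding g_def
    by (subst fourier_diff) (auto intro!: continuous_intros simp: fourier_mult_left fourier_character)
  have "g x * cnj (g x) = f x * cnj (f x) - cnj c * (character (- k) x * f x)
      - c * cnj (character (- k) x * f x) + c * cnj c * (character k x * character (- k) x)" for x
    by (simp add: g_def cnj_character algebra_simps)
  then have "torus_mean (\<lambda>x. g x * cnj (g x)) = torus_mean (\<lambda>x. f x * cnj (f x) - cnj c * (character (- k) x * f x)
      - c * cnj (character (- k) x * f x) + c * cnj c)" by simp
  also have "\<dots> = torus_mean (\<lambda>x. f x * cnj (f x)) - cnj c * c - c * cnj c + c * cnj c"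
  proof -
    have c: "continuous_on UNIV (\<lambda>x. f x * cnj (f x))"
      "continuous_on UNIV (\<lambda>x. cnj c * (character (- k) x * f x))"
      "continuous_on UNIV (\<lambda>x. c * cnj (character (- k) x * f x))"
      using insert(4) by (auto intro!: continuous_intros)
    show ?thesis
      using torus_mean_add[OF continuous_on_diff[OF continuous_on_diff[OF c(1,2)] c(3)] continuous_on_const]
        torus_mean_diff[OF continuous_on_diff[OF c(1,2)] c(3)] torus_mean_diff[OF c(1,2)]
      by (simp only: torus_mean_mult_left torus_mean_cnj torus_mean_const c_def fourier_def)
  qed
  also have "\<dots> = torus_mean (\<lambda>x. f x * cnj (f x)) - of_real ((norm c)\<^sup>2)"
    by (simp add: mult.commute[of "cnj c"] flip: complex_norm_square)
  finally have "Re (torus_mean (\<lambda>x. g x * cnj (g x))) = Re (torus_mean (\<lambda>x. f x * cnj (f x))) - (norm c)\<^sup>2"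
    by (simp only: minus_complex.simps Re_complex_of_real)
  moreover have "(\<Sum>k\<in>B. (norm (fourier f k))\<^sup>2) \<le> Re (torus_mean (\<lambda>x. g x * cnj (g x)))"
    using insert.IH[OF g] fg by simp
  ultimately show ?case using insert by (simp add: c_def)
qed

lemma Bessel_bounded:
  assumes "finite B" "continuous_on UNIV f" "\<And>x. x \<in> cbox 0 1 \<Longrightarrow> norm (f x) \<le> M"
  shows "(\<Sum>k\<in>B. (norm (fourier f k))\<^sup>2) \<le> M\<^sup>2"
proof -
  have "Re (torus_mean (\<lambda>x. f x * cnj (f x))) \<le> norm (torus_mean (\<lambda>x. f x * cnj (f x)))"
    by (rule complex_Re_le_cmod)
  also have "\<dots> \<le> M\<^sup>2"
    using assms(3) by (intro norm_torus_mean_le continuous_intros assms)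
      (auto simp: norm_mult power2_eq_square intro!: mult_mono' )
  finally show ?thesis using Bessel[OF assms(1,2)] by linarith
qed

lemma has_vector_derivative_along:
  assumes "\<And>x. (f has_derivative f' x) (at x)"
  shows "((\<lambda>t. f (x + t *\<^sub>R e)) has_vector_derivative f' (x + t *\<^sub>R e) e) (at t within U)"
proof -
  have "((\<lambda>t. x + t *\<^sub>R e) has_derivative (\<lambda>s. s *\<^sub>R e)) (at t within U)"
    by (auto intro!: derivative_eq_intros)
  from has_derivative_compose[OF this assms]
  have "((\<lambda>t. f (x + t *\<^sub>R e)) has_derivative (\<lambda>s. f' (x + t *\<^sub>R e) (s *\<^sub>R e))) (at t within U)" .
  moreover have "f' (x + t *\<^sub>R e) (s *\<^sub>R e) = s *\<^sub>R f' (x + t *\<^sub>R e) e" for s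
    using assms[THEN has_derivative_linear] linear_scale by blast
  ultimately show ?thesis by (simp add: has_vector_derivative_def)
qed

text \<open>The mean of the translates of \<open>f\<close> is constant; differentiate it under the integral sign.\<close>

lemma torus_mean_derivative:
  assumes f: "\<And>x. (f has_derivative f' x) (at x)" "periodic f"
    and cont: "continuous_on UNIV (\<lambda>x. f' x (axis i 1))"
  shows "torus_mean (\<lambda>x. f' x (axis i 1)) = 0"
proof -
  let ?e = "axis i 1" and ?I = "\<lambda>t. torus_mean (\<lambda>x. f (x + t *\<^sub>R axis i 1))"
  have cf: "continuous_on UNIV f"
    using f(1) by (auto intro!: continuous_at_imp_continuous_on has_derivative_continuous)
  have A: "(?I has_vector_derivative torus_mean (\<lambda>x. f' (x + 0 *\<^sub>R ?e) ?e)) (at 0 within {0..1})"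
    unfolding torus_mean_def
    by (rule leibniz_rule_vector_derivative[where f = "\<lambda>t x. f (x + t *\<^sub>R ?e)" and
          fx = "\<lambda>t x. f' (x + t *\<^sub>R ?e) ?e"])
      (auto simp: split_beta intro!: has_vector_derivative_along[OF f(1)] integrable_on_cbox_if_continuous
        continuous_on_compose2[OF cf] continuous_on_compose2[OF cont] continuous_intros)
  have B: "(?I has_vector_derivative 0) (at 0 within {0..1})"
  proof (rule has_vector_derivative_transform[where f = "\<lambda>t. torus_mean f"])
    show "?I t = torus_mean f" if "t \<in> {0..1}" for t
      using torus_mean_translate_axis[OF cf f(2)] that by simp
  qed auto
  show ?thesis
    using vector_derivative_unique_within[OF _ A B] at_within_Icc_at_right[of 0 "1::real"] by simp
qed

lemma character_has_derivative:
  "(character k has_derivative (\<lambda>e. (\<i> * of_real (2 * pi * int_pairing k e)) * character k x)) (at x)"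
proof -
  have *: "(character k has_derivative (\<lambda>e. (2 * pi * int_pairing k e) *\<^sub>R (\<i> * cis (2 * pi * int_pairing k x)))) (at x)"
    unfolding character_def[abs_def]
    by (intro has_derivative_cis has_derivative_mult_right
        bounded_linear_imp_has_derivative bounded_linear_int_pairing)
  show ?thesis
    by (rule has_derivative_eq_rhs[OF *]) (simp add: character_def scaleR_conv_of_real algebra_simps)
qed

text \<open>Integration by parts: \<open>torus_mean_derivative\<close> for the product of \<open>f\<close> with a character.\<close>

lemma fourier_derivative:
  assumes f: "\<And>x. (f has_derivative f' x) (at x)" "periodic f"
    and cont: "continuous_on UNIV (\<lambda>x. f' x (axis i 1))"
  shows "fourier (\<lambda>x. f' x (axis i 1)) k = 2 * pi * \<i> * of_int (k $ i) * fourier f k"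
proof -
  let ?e = "axis i 1 :: real ^ 'a"
  define g' where "g' x e = character (- k) x * f' x e
    + (\<i> * of_real (2 * pi * int_pairing (- k) e) * character (- k) x) * f x" for x e
  have cf: "continuous_on UNIV f"
    using f(1) by (auto intro!: continuous_at_imp_continuous_on has_derivative_continuous)
  have g: "((\<lambda>x. character (- k) x * f x) has_derivative g' x) (at x)" for x
    unfolding g'_def by (rule has_derivative_mult[OF character_has_derivative f(1)])
  have pe: "int_pairing (- k) ?e = - of_int (k $ i)"
    using int_pairing_axis[of "- k" 1 i] by simp
  have g'e: "g' x ?e = character (- k) x * f' x ?e - (2 * pi * \<i> * of_int (k $ i)) * (character (- k) x * f x)" for x
    unfolding g'_def pe by (simp add: algebra_simps)
  have "torus_mean (\<lambda>x. g' x ?e) = 0"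
    using g by (rule torus_mean_derivative)
      (auto simp: g'e intro!: periodic_compose2[where h = "(*)"] periodic_character f continuous_intros cont cf)
  then show ?thesis
    unfolding g'e using cont cf
    by (subst (asm) torus_mean_diff) (auto intro!: continuous_intros simp: torus_mean_mult_left fourier_def)
qed

section \<open>Uniqueness of Fourier coefficients\<close>

text \<open>The functions that have to be shown to vanish.  They form a module over the trigonometric polynomials,
  which replaces any expansion of polynomials in cosines and sines into characters.\<close>

definition null_fourier :: "(real ^ 'n::finite \<Rightarrow> complex) \<Rightarrow> bool" where
  "null_fourier f \<longleftrightarrow> continuous_on UNIV f \<and> periodic f \<and> (\<forall>k. fourier f k = 0)"

lemma null_fourier_add:
  assumes "null_fourier f" "null_fourier g" shows "null_fourier (\<lambda>x. f x + g x)"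
  using assms periodic_compose2[of f g "(+)"]
  by (simp add: null_fourier_def fourier_add continuous_on_add)

lemma null_fourier_mult_left:
  assumes "null_fourier f" shows "null_fourier (\<lambda>x. c * f x)"
  using assms periodic_compose[of f "(*) c"]
  by (simp add: null_fourier_def fourier_mult_left continuous_on_mult_left)

lemma null_fourier_mult_character:
  assumes "null_fourier f" shows "null_fourier (\<lambda>x. character l x * f x)"
  using assms periodic_compose2[OF periodic_character, of f "(*)" l]
  by (simp add: null_fourier_def fourier_mult_character continuous_on_mult continuous_on_character)

lemma null_fourier_sum:
  assumes "finite I" "\<And>i. i \<in> I \<Longrightarrow> null_fourier (g i)"
  shows "null_fourier (\<lambda>x. \<Sum>i\<in>I. g i x)"
  using assms
proof (induction I rule: finite_induct)
  case empty
  have "fourier (\<lambda>x. 0) k = 0" for k :: "int ^ 'b" using fourier_mult_left[of 0 "\<lambda>_. 0" k] by simp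
  then show ?case by (simp add: null_fourier_def periodic_def)
next
  case (insert i I)
  then show ?case by (simp add: null_fourier_add)
qed

text \<open>The torus as a compact subset of a Euclidean space, where the approximation theorem for polynomials
  applies.\<close>

definition torus_embed :: "real ^ 'n::finite \<Rightarrow> complex ^ 'n" where
  "torus_embed x = (\<chi> i. cis (2 * pi * x $ i))"

lemma continuous_on_torus_embed: "continuous_on S torus_embed"
  unfolding torus_embed_def[abs_def] by (intro continuous_intros)

lemma torus_embed_eqD:
  assumes "torus_embed x = torus_embed y" shows "torus_proj x = torus_proj y"
  unfolding torus_proj_eq_iff
proof
  fix i
  have "cis (2 * pi * x $ i) = cis (2 * pi * y $ i)"
    using assms by (simp add: torus_embed_def vec_eq_iff)
  then have "sin (2 * pi * x $ i) = sin (2 * pi * y $ i) \<and> cos (2 * pi * x $ i) = cos (2 * pi * y $ i)"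
    by (simp add: complex_eq_iff)
  then obtain n :: int where "2 * pi * x $ i = 2 * pi * y $ i + 2 * pi * n"
    unfolding sin_cos_eq_iff by blast
  then have "2 * pi * (x $ i) = 2 * pi * (y $ i + n)" by (simp add: algebra_simps)
  then have "x $ i = y $ i + n" by simp
  then show "x $ i - y $ i \<in> \<int>" by simp
qed

lemma torus_embed_cong:
  assumes "torus_proj x = torus_proj y" shows "torus_embed x = torus_embed y"
proof -
  have "cis (2 * pi * x $ i) = cis (2 * pi * y $ i)" for i
  proof -
    have "cis (2 * pi * (x $ i - y $ i)) = 1"
      using assms by (simp add: torus_proj_eq_iff cis_multiple_2pi)
    then show ?thesis using cis_mult[of "2 * pi * (x $ i - y $ i)" "2 * pi * y $ i"]
      by (simp add: algebra_simps)
  qed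
  then show ?thesis by (simp add: torus_embed_def)
qed

lemma ex_unit_cube_representative:
  obtains y where "y \<in> cbox 0 1" "torus_proj y = torus_proj x"
proof
  show "(\<chi> i. frac (x $ i)) \<in> cbox 0 1"
    by (auto simp: mem_box_cart less_imp_le[OF frac_lt_1])
  show "torus_proj (\<chi> i. frac (x $ i)) = torus_proj x"
    by (simp add: torus_proj_eq_iff frac_def)
qed

lemma torus_embed_unit_cube:
  "torus_embed ` cbox 0 (1 :: real ^ 'n::finite) = range torus_embed"
proof -
  have "torus_embed x \<in> torus_embed ` cbox 0 1" for x :: "real ^ 'n"
  proof -
    obtain y where "y \<in> cbox 0 1" "torus_proj y = torus_proj x" by (rule ex_unit_cube_representative)
    then show ?thesis by (metis image_eqI torus_embed_cong)
  qed
  then show ?thesis by blast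
qed

text \<open>Euler's formulas: real-linear functions of the embedded point are combinations of characters.\<close>

lemma linear_torus_embed_eq_characters:
  assumes L: "bounded_linear (L :: complex ^ 'n::finite \<Rightarrow> real)"
  shows "of_real (L (torus_embed x)) = (\<Sum>i\<in>UNIV.
     (L (axis i 1) - \<i> * L (axis i \<i>)) / 2 * character (axis i 1) x
   + (L (axis i 1) + \<i> * L (axis i \<i>)) / 2 * character (- axis i 1) x)"
proof -
  let ?term = "\<lambda>i. cos (2 * pi * x $ i) *\<^sub>R axis i (1 :: complex) + sin (2 * pi * x $ i) *\<^sub>R axis i \<i>"
  have comp: "?term i $ j = (if i = j then cis (2 * pi * x $ j) else 0)" for i j
  proof (cases "i = j")
    case True
    then show ?thesis by (simp add: axis_def cis.ctr) (simp add: complex_eq_iff)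
  next
    case False
    then show ?thesis by (simp add: axis_def)
  qed
  have "torus_embed x = (\<Sum>i\<in>UNIV. ?term i)"
    unfolding vec_eq_iff sum_component comp by (simp add: torus_embed_def)
  then have "L (torus_embed x)
      = (\<Sum>i\<in>UNIV. L (axis i 1) * cos (2 * pi * x $ i) + L (axis i \<i>) * sin (2 * pi * x $ i))"
    using L by (simp add: linear_sum bounded_linear.linear linear_add linear_scale mult.commute)
  also have "of_real \<dots> = (\<Sum>i\<in>UNIV.
     (L (axis i 1) - \<i> * L (axis i \<i>)) / 2 * cis (2 * pi * x $ i)
   + (L (axis i 1) + \<i> * L (axis i \<i>)) / 2 * cis (2 * pi * - x $ i))"
    unfolding of_real_sum by (intro sum.cong refl) (simp add: complex_eq_iff add_divide_distrib diff_divide_distrib)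
  also have "\<dots> = (\<Sum>i\<in>UNIV.
     (L (axis i 1) - \<i> * L (axis i \<i>)) / 2 * character (axis i 1) x
   + (L (axis i 1) + \<i> * L (axis i \<i>)) / 2 * character (- axis i 1) x)"
  proof -
    have "int_pairing (axis i 1) x = x $ i" for i
    proof -
      have "int_pairing (axis i 1) x = (\<Sum>j\<in>UNIV. if j = i then x $ i else 0)"
        unfolding int_pairing_def by (intro sum.cong) (auto simp: axis_def)
      then show ?thesis by simp
    qed
    then show ?thesis unfolding character_def int_pairing_minus_left by simp
  qed
  finally show ?thesis .
qed

lemma null_fourier_mult_polynomial:
  assumes "real_polynomial_function p" "null_fourier f"
  shows "null_fourier (\<lambda>x. of_real (p (torus_embed x)) * f x)"
  using assms
proof (induction p arbitrary: f rule: real_polynomial_function.induct)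
  case (linear L)
  show ?case
    unfolding linear_torus_embed_eq_characters[OF linear(1)] sum_distrib_right distrib_right mult.assoc
    by (intro null_fourier_sum null_fourier_add null_fourier_mult_left null_fourier_mult_character linear) auto
next
  case (const c)
  then show ?case by (rule null_fourier_mult_left)
next
  case (add p q)
  then show ?case by (simp add: distrib_right null_fourier_add)
next
  case (mult p q)
  then show ?case by (simp add: mult.assoc)
qed

text \<open>A continuous map from a compact space onto a Hausdorff space is a quotient map, so a periodic function
  descends to a continuous function on the embedded torus.\<close>

lemma periodic_factor_torus_embed:
  assumes f: "continuous_on UNIV f" "periodic f"
  obtains F where "continuous_on (range torus_embed) F" "\<And>x. F (torus_embed x) = f x"
proof -
  define F where "F y = f (SOME x. torus_embed x = y)" for y
  have F: "F (torus_embed x) = f x" for x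
  proof -
    have "torus_embed (SOME x'. torus_embed x' = torus_embed x) = torus_embed x"
      by (rule someI) simp
    then show ?thesis using f(2) torus_embed_eqD unfolding F_def periodic_def by blast
  qed
  let ?Q = "cbox 0 1 :: (real ^ 'a) set" and ?S = "range torus_embed :: (complex ^ 'a) set"
  have S: "torus_embed ` ?Q = ?S" by (rule torus_embed_unit_cube)
  have "continuous_on ?S F"
  proof (subst continuous_on_open_gen[where T = UNIV]; safe)
    fix U :: "'b set" assume U: "openin (top_of_set UNIV) U"
    have "?Q \<inter> torus_embed -` (?S \<inter> F -` U) = ?Q \<inter> f -` U"
      unfolding vimage_def using F by auto
    moreover have "openin (top_of_set ?Q) (?Q \<inter> f -` U)"
      using continuous_on_subset[OF f(1), of ?Q] U by (auto intro: continuous_openin_preimage_gen)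
    ultimately show "openin (top_of_set ?S) (?S \<inter> F -` U)"
      using Abstract_Topology_2.continuous_imp_quotient_map[OF continuous_on_torus_embed S compact_cbox, of "?S \<inter> F -` U"] by simp
  qed auto
  then show thesis using that F by blast
qed

text \<open>If \<open>T\<close> is a polynomial on the embedded torus that is uniformly close to the conjugate of \<open>f\<close>, then the
  mean of \<open>T * f\<close> vanishes and is close to the mean square of \<open>f\<close>.\<close>

theorem null_fourier_imp_0:
  assumes "null_fourier f" shows "f x = 0"
proof -
  have f: "continuous_on UNIV f" "periodic f" using assms by (auto simp: null_fourier_def)
  obtain F where F: "continuous_on (range torus_embed) F" "\<And>x. F (torus_embed x) = f x"
    using periodic_factor_torus_embed[OF f] by metis
  let ?Q = "cbox 0 1 :: (real ^ 'a) set"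
  have S: "compact (range (torus_embed :: real ^ 'a \<Rightarrow> _))"
    unfolding torus_embed_unit_cube[symmetric]
    by (intro compact_continuous_image continuous_on_torus_embed compact_cbox)
  have "bounded (f ` ?Q)"
    using f(1) by (intro compact_imp_bounded compact_continuous_image) (auto intro: continuous_on_subset)
  then obtain M where M: "\<And>x. x \<in> ?Q \<Longrightarrow> norm (f x) \<le> M"
    unfolding bounded_iff by blast
  have "(0 :: real ^ 'a) \<in> ?Q" by (simp add: mem_box_cart)
  then have M0: "0 \<le> M" using M norm_ge_zero order_trans by blast
  define I where "I = torus_mean (\<lambda>x. cnj (f x) * f x)"
  have small: "norm I \<le> \<epsilon> * M" if eps: "\<epsilon> > 0" for \<epsilon>
  proof -
    have cF: "continuous_on (range torus_embed) (\<lambda>y. cnj (F y))" using F(1) by (intro continuous_intros)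
    obtain q where q: "polynomial_function q" "\<forall>y \<in> range torus_embed. norm (cnj (F y) - q y) < \<epsilon>"
      using Stone_Weierstrass_polynomial_function[OF S cF eps] by blast
    have "real_polynomial_function (Re \<circ> q)" "real_polynomial_function (Im \<circ> q)"
      using q(1) bounded_linear_Re bounded_linear_Im unfolding polynomial_function_def by blast+
    then have "null_fourier (\<lambda>x. of_real ((Re \<circ> q) (torus_embed x)) * f x
        + \<i> * (of_real ((Im \<circ> q) (torus_embed x)) * f x))"
      using assms by (intro null_fourier_add null_fourier_mult_left null_fourier_mult_polynomial)
    moreover have "of_real ((Re \<circ> q) y) * z + \<i> * (of_real ((Im \<circ> q) y) * z) = q y * z" for y z
      by (simp add: complex_eq_iff)
    ultimately have T: "null_fourier (\<lambda>x. q (torus_embed x) * f x)" by simp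
    then have "fourier (\<lambda>x. q (torus_embed x) * f x) 0 = 0" by (simp add: null_fourier_def)
    then have "torus_mean (\<lambda>x. q (torus_embed x) * f x) = 0" by (simp add: fourier_def)
    moreover have "continuous_on UNIV (\<lambda>x. q (torus_embed x) * f x)" using T by (simp add: null_fourier_def)
    moreover have "continuous_on UNIV (\<lambda>x. cnj (f x) * f x)" using f by (intro continuous_intros)
    ultimately have "I = torus_mean (\<lambda>x. cnj (f x) * f x - q (torus_embed x) * f x)"
      and c: "continuous_on UNIV (\<lambda>x. cnj (f x) * f x - q (torus_embed x) * f x)"
      unfolding I_def by (simp_all add: torus_mean_diff continuous_on_diff)
    moreover have "norm (cnj (f x) * f x - q (torus_embed x) * f x) \<le> \<epsilon> * M" if "x \<in> ?Q" for x
      using bspec[OF q(2), of "torus_embed x"] M[OF that] M0 F(2) eps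
      by (auto simp: norm_mult simp flip: left_diff_distrib intro!: mult_mono)
    ultimately show ?thesis using norm_torus_mean_le[OF c] by simp
  qed
  have "norm I \<le> 0"
  proof (rule field_le_epsilon)
    fix e :: real assume "0 < e"
    then have "norm I \<le> e / (M + 1) * M" using M0 by (intro small) auto
    also have "\<dots> \<le> e" using M0 \<open>0 < e\<close> by (simp add: field_simps)
    finally show "norm I \<le> 0 + e" by simp
  qed
  then have "Re I = 0" by simp
  moreover have cont: "continuous_on UNIV (\<lambda>x. cnj (f x) * f x)" using f by (intro continuous_intros)
  ultimately have "integral ?Q (\<lambda>x. Re (cnj (f x) * f x)) = 0"
    by (simp only: I_def flip: Re_torus_mean)
  moreover have contR: "continuous_on S (\<lambda>x. Re (cnj (f x) * f x))" for S
    using cont by (intro continuous_intros) (auto intro: continuous_on_subset f)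
  ultimately have int: "((\<lambda>x. Re (cnj (f x) * f x)) has_integral 0) ?Q"
    using integrable_on_cbox_if_continuous by (metis has_integral_integral)
  have "box 0 (1 :: real ^ 'a) \<noteq> {}" by (simp add: interval_ne_empty_cart)
  then have Q0: "f y = 0" if "y \<in> ?Q" for y
    using has_integral_0_cbox_imp_0[OF contR _ int _ that] 
    by (auto simp: complex_eq_iff sum_squares_eq_zero_iff simp flip: power2_eq_square)
  obtain y where "y \<in> ?Q" "torus_proj y = torus_proj x" using ex_unit_cube_representative by blast
  then show ?thesis using f(2) Q0 unfolding periodic_def by metis
qed

section \<open>Decay of Fourier coefficients over dyadic blocks\<close>

lemma periodic_frechet_derivative:
  fixes f :: "real ^ 'n::finite \<Rightarrow> 'b::real_normed_vector"
  assumes f: "\<And>x. f differentiable (at x)" "periodic f"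
  shows "periodic (\<lambda>x. frechet_derivative f (at x) e)"
  unfolding periodic_def
proof (intro allI impI)
  fix x y :: "real ^ 'n" assume xy: "torus_proj x = torus_proj y"
  have "torus_proj z = torus_proj (z + (y - x))" for z
    using xy unfolding torus_proj_eq_iff by (simp add: algebra_simps)
  then have shift: "f (z + (y - x)) = f z" for z using f(2) unfolding periodic_def by metis
  have "(f has_derivative frechet_derivative f (at y)) (at (x + (y - x)))"
    using f(1)[of y] by (simp add: frechet_derivative_works)
  moreover have "((\<lambda>z. z + (y - x)) has_derivative (\<lambda>h. h)) (at x)"
    by (auto intro!: derivative_eq_intros)
  ultimately have "((\<lambda>z. f (z + (y - x))) has_derivative frechet_derivative f (at y)) (at x)"
    using has_derivative_compose[of "\<lambda>z. z + (y - x)" "\<lambda>h. h" x UNIV f] by simp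
  then have "(f has_derivative frechet_derivative f (at y)) (at x)" by (simp add: shift)
  then have "frechet_derivative f (at y) = frechet_derivative f (at x)"
    by (rule frechet_derivative_at)
  then show "frechet_derivative f (at x) e = frechet_derivative f (at y) e" by simp
qed

text \<open>Translation by \<open>t\<close> along the axis \<open>i\<close> multiplies the coefficient at \<open>k\<close> by the value of a character.
  Bessel's inequality for the difference of a translate and the function itself therefore turns the
  Hoelder modulus of the \<open>m\<close>th derivative in direction \<open>i\<close> into a bound on the coefficients, to which each
  derivative contributes a factor \<open>2 \<pi> \<bar>k $ i\<bar>\<close>.  For \<open>\<alpha> = 0\<close> the role of the modulus is played by a
  bound for the function, so integer classes lose nothing.\<close>

lemma fourier_differences_square_sum:
  assumes "C_k_alpha m \<alpha> f" "periodic f" "0 \<le> \<alpha>"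
  shows "\<exists>C\<ge>0. \<forall>t\<in>{0<..1}. \<forall>B. finite B \<longrightarrow>
    (\<Sum>k\<in>B. (\<bar>of_int (k $ i)\<bar> ^ m * norm (fourier f k) * norm (character k (t *\<^sub>R axis i 1) - 1))\<^sup>2)
      \<le> (C * t powr \<alpha>)\<^sup>2"
  using assms(1,2)
proof (induction m arbitrary: f)
  case 0
  let ?K = "cbox 0 (1 + 1) :: (real ^ 'a) set"
  have f: "continuous_on UNIV f" using 0 by simp
  have K: "x \<in> ?K" "x + t *\<^sub>R axis i 1 \<in> ?K" if "x \<in> cbox 0 1" "t \<in> {0<..1}" for x t
  proof -
    have "0 \<le> x $ j \<and> x $ j \<le> 1" "0 \<le> (t *\<^sub>R axis i 1 :: real ^ 'a) $ j \<and> (t *\<^sub>R axis i 1 :: real ^ 'a) $ j \<le> 1" for j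
      using that by (auto simp: mem_box_cart axis_def)
    then show "x \<in> ?K" "x + t *\<^sub>R axis i 1 \<in> ?K" 
      unfolding mem_box_cart by (auto simp del: vector_scaleR_component intro!: add_nonneg_nonneg)
        (smt (verit))+
  qed
  obtain C where C: "C \<ge> 0" "\<And>x t. x \<in> cbox 0 1 \<Longrightarrow> t \<in> {0<..1} \<Longrightarrow>
      norm (f (x + t *\<^sub>R axis i 1) - f x) \<le> C * t powr \<alpha>"
  proof (cases "\<alpha> > 0")
    case True
    then have "locally_Hoelder \<alpha> f" using 0 by simp
    then obtain C where C: "C \<ge> 0" "\<And>x y. x \<in> ?K \<Longrightarrow> y \<in> ?K \<Longrightarrow> norm (f x - f y) \<le> C * norm (x - y) powr \<alpha>"
      by (rule locally_HoelderE[OF _ compact_cbox]) blast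
    have "norm (f (x + t *\<^sub>R axis i 1) - f x) \<le> C * t powr \<alpha>" if "x \<in> cbox 0 1" "t \<in> {0<..1}" for x t
      using C(2)[OF K(2)[OF that] K(1)[OF that]] that by simp
    then show thesis using that C(1) by blast
  next
    case False
    then have [simp]: "\<alpha> = 0" using assms(3) by simp
    have "bounded (f ` ?K)"
      using f by (intro compact_imp_bounded compact_continuous_image) (auto intro: continuous_on_subset)
    then obtain M where M: "\<And>x. x \<in> ?K \<Longrightarrow> norm (f x) \<le> M" unfolding bounded_iff by blast
    have "norm (f (x + t *\<^sub>R axis i 1) - f x) \<le> 2 * \<bar>M\<bar> * t powr \<alpha>" if "x \<in> cbox 0 1" "t \<in> {0<..1}" for x t
      using norm_triangle_ineq4[of "f (x + t *\<^sub>R axis i 1)" "f x"] M[OF K(1)[OF that]] M[OF K(2)[OF that]] that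
      by simp
    then show thesis using that[of "2 * \<bar>M\<bar>"] by simp
  qed
  have "(\<Sum>k\<in>B. (norm (fourier f k) * norm (character k (t *\<^sub>R axis i 1) - 1))\<^sup>2) \<le> (C * t powr \<alpha>)\<^sup>2"
    if t: "t \<in> {0<..1}" and B: "finite B" for t B
  proof -
    let ?g = "\<lambda>x. f (x + t *\<^sub>R axis i 1)"
    have g: "continuous_on UNIV ?g" by (intro continuous_on_compose2[OF f] continuous_intros) auto
    have "fourier (\<lambda>x. ?g x - f x) k = fourier f k * (character k (t *\<^sub>R axis i 1) - 1)" for k
      using t fourier_translate_axis[OF f 0(2)] by (simp add: fourier_diff[OF g f] algebra_simps)
    then have "(\<Sum>k\<in>B. (norm (fourier f k) * norm (character k (t *\<^sub>R axis i 1) - 1))\<^sup>2)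
        = (\<Sum>k\<in>B. (norm (fourier (\<lambda>x. ?g x - f x) k))\<^sup>2)" by (simp add: norm_mult)
    also have "\<dots> \<le> (C * t powr \<alpha>)\<^sup>2"
      using C(2)[OF _ t] by (intro Bessel_bounded B continuous_on_diff g f) auto
    finally show ?thesis .
  qed
  then show ?case using C(1) by (intro exI[of _ C]) simp
next
  case (Suc m)
  define f' where "f' x = frechet_derivative f (at x)" for x
  have f': "(f has_derivative f' x) (at x)" for x
    unfolding f'_def using Suc.prems(1) by (rule C_k_alpha_Suc_has_derivative)
  have e: "axis i 1 \<in> (Basis :: (real ^ 'a) set)" by (simp add: axis_in_Basis_iff)
  have Cm: "C_k_alpha m \<alpha> (\<lambda>x. f' x (axis i 1))" using Suc.prems(1) e by (simp add: f'_def)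
  have per: "periodic (\<lambda>x. f' x (axis i 1))"
    unfolding f'_def using Suc.prems by (intro periodic_frechet_derivative) auto
  obtain C where C: "C \<ge> 0" "\<And>t B. t \<in> {0<..1} \<Longrightarrow> finite B \<Longrightarrow>
    (\<Sum>k\<in>B. (\<bar>of_int (k $ i)\<bar> ^ m * norm (fourier (\<lambda>x. f' x (axis i 1)) k) * norm (character k (t *\<^sub>R axis i 1) - 1))\<^sup>2)
      \<le> (C * t powr \<alpha>)\<^sup>2"
    using Suc.IH[OF Cm per] by blast
  have coeff: "\<bar>of_int (k $ i)\<bar> * norm (fourier f k) \<le> norm (fourier (\<lambda>x. f' x (axis i 1)) k)" for k
  proof -
    have "1 * (\<bar>of_int (k $ i)\<bar> * norm (fourier f k)) \<le> (2 * pi) * (\<bar>of_int (k $ i)\<bar> * norm (fourier f k))"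
      using pi_ge_two by (intro mult_right_mono) auto
    then show ?thesis
      using fourier_derivative[OF f' Suc.prems(2) C_k_alpha_continuous[OF Cm], of k]
      by (simp add: norm_mult mult.assoc)
  qed
  have "(\<Sum>k\<in>B. (\<bar>of_int (k $ i)\<bar> ^ Suc m * norm (fourier f k) * norm (character k (t *\<^sub>R axis i 1) - 1))\<^sup>2)
      \<le> (C * t powr \<alpha>)\<^sup>2" if t: "t \<in> {0<..1}" "finite B" for t B
  proof (rule order_trans[OF sum_mono C(2)[OF t]])
    fix k
    have "\<bar>of_int (k $ i)\<bar> ^ Suc m * norm (fourier f k) * norm (character k (t *\<^sub>R axis i 1) - 1)
        = \<bar>of_int (k $ i)\<bar> ^ m * (\<bar>of_int (k $ i)\<bar> * norm (fourier f k)) * norm (character k (t *\<^sub>R axis i 1) - 1)"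
      by simp
    also have "\<dots> \<le> \<bar>of_int (k $ i)\<bar> ^ m * norm (fourier (\<lambda>x. f' x (axis i 1)) k) * norm (character k (t *\<^sub>R axis i 1) - 1)"
      by (intro mult_right_mono mult_left_mono coeff) auto
    finally show "(\<bar>of_int (k $ i)\<bar> ^ Suc m * norm (fourier f k) * norm (character k (t *\<^sub>R axis i 1) - 1))\<^sup>2
        \<le> (\<bar>of_int (k $ i)\<bar> ^ m * norm (fourier (\<lambda>x. f' x (axis i 1)) k) * norm (character k (t *\<^sub>R axis i 1) - 1))\<^sup>2"
      by (intro power_mono) auto
  qed
  then show ?case using C(1) by blast
qed

definition int_norm :: "int ^ 'n::finite \<Rightarrow> real" where
  "int_norm k = (\<Sum>i\<in>UNIV. \<bar>of_int (k $ i)\<bar>)"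

text \<open>The blocks partition the nonzero integer vectors (see \<open>mem_dyadic_block_iff\<close>).\<close>

definition dyadic_block :: "nat \<Rightarrow> (int ^ 'n::finite) set" where
  "dyadic_block j = {k. 2 ^ j \<le> int_norm k \<and> int_norm k < 2 ^ Suc j}"

lemma int_norm_component: "\<bar>of_int (k $ i)\<bar> \<le> int_norm k"
  unfolding int_norm_def by (rule member_le_sum) auto

lemma int_norm_diff_le: "int_norm (k - l) \<le> int_norm k + int_norm l"
  unfolding int_norm_def sum.distrib[symmetric] by (intro sum_mono) simp

lemma int_norm_eq_0_iff [simp]: "int_norm k = 0 \<longleftrightarrow> k = 0"
  unfolding int_norm_def by (subst sum_nonneg_eq_0_iff) (auto simp: vec_eq_iff)

lemma int_norm_nonneg [simp]: "0 \<le> int_norm k"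
  by (simp add: int_norm_def sum_nonneg)

lemma int_norm_ge_1:
  assumes "k \<noteq> 0" shows "1 \<le> int_norm k"
proof -
  have "int_norm k = of_int (\<Sum>i\<in>UNIV. \<bar>k $ i\<bar>)" by (simp add: int_norm_def)
  moreover have "int_norm k > 0" using assms int_norm_nonneg int_norm_eq_0_iff by (metis less_eq_real_def)
  ultimately have "0 < (\<Sum>i\<in>UNIV. \<bar>k $ i\<bar>)" by linarith
  then show ?thesis using \<open>int_norm k = _\<close> by linarith
qed

lemma zero_notin_dyadic_block: "0 \<notin> dyadic_block j"
  by (simp add: dyadic_block_def int_norm_def not_le)

lemma mem_dyadic_block_iff:
  assumes "k \<noteq> 0" shows "k \<in> dyadic_block j \<longleftrightarrow> j = nat \<lfloor>log 2 (int_norm k)\<rfloor>"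
proof -
  have k: "1 \<le> int_norm k" using assms by (rule int_norm_ge_1)
  then have "0 \<le> \<lfloor>log 2 (int_norm k)\<rfloor>" by simp
  then have "j = nat \<lfloor>log 2 (int_norm k)\<rfloor> \<longleftrightarrow> \<lfloor>log 2 (int_norm k)\<rfloor> = int j" by auto
  also have "\<dots> \<longleftrightarrow> k \<in> dyadic_block j"
    using k by (simp add: dyadic_block_def floor_eq_iff le_log_iff log_less_iff powr_realpow powr_add mult.commute)
  finally show ?thesis ..
qed

lemma finite_bounded_int_vec: "finite {k :: int ^ 'n::finite. \<forall>i. k $ i \<in> {- N..N}}"
proof -
  have "k \<in> vec_lambda ` PiE UNIV (\<lambda>_. {- N..N})" if "\<forall>i. k $ i \<in> {- N..N}" for k :: "int ^ 'n"
    using that by (intro image_eqI[of _ _ "vec_nth k"]) (auto simp: vec_nth_inverse)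
  then have "{k :: int ^ 'n. \<forall>i. k $ i \<in> {- N..N}} \<subseteq> vec_lambda ` PiE UNIV (\<lambda>_. {- N..N})" by blast
  moreover have "finite (PiE (UNIV :: 'n set) (\<lambda>_. {- N..N}))" by (rule finite_PiE) auto
  ultimately show ?thesis using finite_subset finite_imageI by blast
qed

lemma finite_dyadic_block: "finite (dyadic_block j)"
proof (rule finite_subset[OF _ finite_bounded_int_vec[of "2 ^ Suc j"]], safe)
  fix k :: "int ^ 'a" and i assume "k \<in> dyadic_block j"
  then have "\<bar>real_of_int (k $ i)\<bar> \<le> real_of_int (2 ^ Suc j)"
    using int_norm_component[of k i] by (simp add: dyadic_block_def)
  then have "\<bar>k $ i\<bar> \<le> 2 ^ Suc j" unfolding of_int_abs[symmetric] of_int_le_iff .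
  then show "k $ i \<in> {- (2 ^ Suc j)..2 ^ Suc j}" by auto
qed

text \<open>The modulus is \<open>2 * \<bar>sin (\<pi> \<theta>)\<bar>\<close>; the cubic remainder of the sine is at most two thirds of the
  linear term, as \<open>\<pi> \<theta>\<close> is at most 2 in absolute value.\<close>

lemma norm_cis_minus_1_ge:
  assumes "\<bar>\<theta>\<bar> \<le> 1 / 2" shows "\<bar>\<theta>\<bar> \<le> norm (cis (2 * pi * \<theta>) - 1)"
proof -
  let ?x = "pi * \<theta>"
  have "\<bar>?x\<bar> \<le> 4 * (1 / 2)" unfolding abs_mult using assms pi_less_4 by (intro mult_mono) auto
  then have x2: "\<bar>?x\<bar> \<le> 2" by simp
  have "(\<Sum>m<3. sin_coeff m * ?x ^ m) = ?x" by (simp add: numeral_3_eq_3 sin_coeff_def)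
  then have "\<bar>sin ?x - ?x\<bar> \<le> \<bar>?x\<bar> ^ 3 / 6"
    using Maclaurin_sin_bound[of ?x 3] by (simp add: fact_numeral)
  moreover have "\<bar>?x\<bar> ^ 3 \<le> \<bar>?x\<bar> * 4"
    using power_mono[OF x2, of 2] mult_left_mono[of "\<bar>?x\<bar>\<^sup>2" 4 "\<bar>?x\<bar>"]
    by (simp only: power2_eq_square power3_eq_cube mult.assoc) simp
  ultimately have "\<bar>?x\<bar> \<le> 3 * \<bar>sin ?x\<bar>" by linarith
  moreover have "2 * \<bar>\<theta>\<bar> \<le> \<bar>?x\<bar>"
    using pi_ge_two by (simp add: abs_mult mult_right_mono)
  moreover have "norm (cis (2 * pi * \<theta>) - 1) = 2 * \<bar>sin ?x\<bar>"
    using dist_exp_i_1[of "2 * pi * \<theta>"] by (simp add: cis_conv_exp)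
  ultimately show ?thesis by linarith
qed

text \<open>Every \<open>k\<close> in the block has a component comparable to the norm of \<open>k\<close>.  For that component \<open>i\<close>,
  \<open>fourier_differences_square_sum\<close> with a step of half the shortest wave length in the block gives the
  right order; summing over \<open>i\<close> covers all \<open>k\<close>.\<close>

lemma fourier_block_decay:
  assumes f: "C_class r f" "periodic f" and r: "0 \<le> r"
  shows "\<exists>C\<ge>0. \<forall>j. (\<Sum>k\<in>dyadic_block j. (norm (fourier f k))\<^sup>2) \<le> (C * 2 powr (- r * j))\<^sup>2"
proof -
  define m where "m = nat \<lfloor>r\<rfloor>"
  define \<alpha> where "\<alpha> = frac r"
  define s where "s = real CARD('a)"
  have s: "s \<ge> 1" by (simp add: s_def Suc_leI)
  have rm: "r = m + \<alpha>" using r by (simp add: m_def \<alpha>_def frac_def)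
  have \<alpha>: "0 \<le> \<alpha>" by (simp add: \<alpha>_def)
  have Cf: "C_k_alpha m \<alpha> f" using f(1) by (simp add: C_class_def m_def \<alpha>_def)
  define P where "P i C \<longleftrightarrow> C \<ge> 0 \<and> (\<forall>t\<in>{0<..1}. \<forall>B. finite B \<longrightarrow>
      (\<Sum>k\<in>B. (\<bar>of_int (k $ i)\<bar> ^ m * norm (fourier f k) * norm (character k (t *\<^sub>R axis i 1) - 1))\<^sup>2)
        \<le> (C * t powr \<alpha>)\<^sup>2)" for i C
  have "\<exists>C. P i C" for i
    using fourier_differences_square_sum[OF Cf f(2) \<alpha>, of i] unfolding P_def .
  then obtain C where "\<And>i. P i (C i)" by metis
  then have C: "\<And>i. C i \<ge> 0" "\<And>i t B. t \<in> {0<..1} \<Longrightarrow> finite B \<Longrightarrow>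
      (\<Sum>k\<in>B. (\<bar>of_int (k $ i)\<bar> ^ m * norm (fourier f k) * norm (character k (t *\<^sub>R axis i 1) - 1))\<^sup>2)
        \<le> (C i * t powr \<alpha>)\<^sup>2" unfolding P_def by blast+
  define D where "D = (\<Sum>i\<in>UNIV. C i)"
  have D: "0 \<le> D" "C i \<le> D" for i
    unfolding D_def using C(1) by (auto intro: sum_nonneg member_le_sum)
  have "(\<Sum>k\<in>dyadic_block j. (norm (fourier f k))\<^sup>2) \<le> (4 * s ^ (m + 2) * D * 2 powr (- r * j))\<^sup>2" for j
  proof -
    \<comment> \<open>On the block, \<open>\<bar>k $ i * t\<bar> \<le> 1 / 2\<close> for every \<open>i\<close>, the range of \<open>norm_cis_minus_1_ge\<close>.\<close>
    define t :: real where "t = 1 / 2 ^ (j + 2)"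
    have t: "t \<in> {0<..1}" using one_le_power[of "2 :: real" "j + 2"] by (simp add: t_def)
    \<comment> \<open>The reciprocal of \<open>(2 ^ j / s) ^ m * (1 / (4 * s))\<close>, a lower bound for the weight of a dominant component.\<close>
    define A where "A = 4 * s ^ Suc m / (2 ^ j) ^ m"
    have A: "0 \<le> A" using s by (simp add: A_def)
    let ?T = "\<lambda>k i. \<bar>of_int (k $ i)\<bar> ^ m * norm (fourier f k) * norm (character k (t *\<^sub>R axis i 1) - 1)"
    have "(norm (fourier f k))\<^sup>2 \<le> (\<Sum>i\<in>UNIV. (A * ?T k i)\<^sup>2)" if k: "k \<in> dyadic_block j" for k
    proof -
      obtain i where i: "2 ^ j / s \<le> \<bar>of_int (k $ i)\<bar>"
      proof (rule ccontr)
        assume "\<not> thesis"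
        then have "\<bar>of_int (k $ i)\<bar> < 2 ^ j / s" for i using that not_le by blast
        then have "int_norm k < (\<Sum>i\<in>(UNIV :: 'a set). 2 ^ j / s)"
          unfolding int_norm_def by (intro sum_strict_mono) auto
        then show False using k s by (simp add: dyadic_block_def s_def)
      qed
      have "\<bar>real_of_int (k $ i)\<bar> < 2 ^ Suc j"
        using k int_norm_component[of k i] by (simp add: dyadic_block_def)
      then have "\<bar>of_int (k $ i) * t\<bar> \<le> 1 / 2" by (simp add: t_def abs_mult field_simps)
      then have "\<bar>of_int (k $ i) * t\<bar> \<le> norm (character k (t *\<^sub>R axis i 1) - 1)"
        unfolding character_def int_pairing_axis by (rule norm_cis_minus_1_ge)
      moreover have "1 / (4 * s) \<le> \<bar>of_int (k $ i) * t\<bar>"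
        using i s by (simp add: t_def abs_mult field_simps)
      ultimately have ch: "1 / (4 * s) \<le> norm (character k (t *\<^sub>R axis i 1) - 1)" by linarith
      have "(2 ^ j / s) ^ m * norm (fourier f k) * (1 / (4 * s)) \<le> ?T k i"
        using i s ch by (intro mult_mono power_mono) auto
      then have "A * ((2 ^ j / s) ^ m * norm (fourier f k) * (1 / (4 * s))) \<le> A * ?T k i"
        using A by (rule mult_left_mono)
      moreover have "A * ((2 ^ j / s) ^ m * norm (fourier f k) * (1 / (4 * s))) = norm (fourier f k)"
        using s by (simp add: A_def field_simps power_divide)
      ultimately have "(norm (fourier f k))\<^sup>2 \<le> (A * ?T k i)\<^sup>2" by (intro power_mono) auto
      also have "\<dots> \<le> (\<Sum>i\<in>UNIV. (A * ?T k i)\<^sup>2)" by (rule member_le_sum) auto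
      finally show ?thesis .
    qed
    then have "(\<Sum>k\<in>dyadic_block j. (norm (fourier f k))\<^sup>2)
        \<le> (\<Sum>k\<in>dyadic_block j. \<Sum>i\<in>UNIV. (A * ?T k i)\<^sup>2)" by (rule sum_mono)
    also have "\<dots> = (\<Sum>i\<in>UNIV. A\<^sup>2 * (\<Sum>k\<in>dyadic_block j. (?T k i)\<^sup>2))"
      by (subst sum.swap) (simp add: power_mult_distrib sum_distrib_left)
    also have "\<dots> \<le> (\<Sum>i\<in>(UNIV :: 'a set). A\<^sup>2 * (D * t powr \<alpha>)\<^sup>2)"
    proof (intro sum_mono mult_left_mono)
      fix i :: 'a
      have "(C i * t powr \<alpha>)\<^sup>2 \<le> (D * t powr \<alpha>)\<^sup>2"
        using C(1) D by (intro power_mono mult_right_mono) auto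
      then show "(\<Sum>k\<in>dyadic_block j. (?T k i)\<^sup>2) \<le> (D * t powr \<alpha>)\<^sup>2"
        using C(2)[OF t finite_dyadic_block] order_trans by blast
    qed auto
    also have "\<dots> = s * (A * D * t powr \<alpha>)\<^sup>2" by (simp add: s_def power_mult_distrib)
    also have "\<dots> \<le> s\<^sup>2 * (A * D * t powr \<alpha>)\<^sup>2"
      using s by (intro mult_right_mono) (auto simp: power2_eq_square)
    also have "\<dots> = (s * A * D * t powr \<alpha>)\<^sup>2" by (simp add: power_mult_distrib)
    also have "\<dots> \<le> (4 * s ^ (m + 2) * D * 2 powr (- r * j))\<^sup>2"
    proof (rule power_mono)
      have "t powr \<alpha> \<le> (1 / 2 ^ j) powr \<alpha>" using \<alpha> by (intro powr_mono2) (auto simp: t_def field_simps)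
      also have "(1 / 2 ^ j) = 2 powr (- real j)" by (simp add: powr_minus powr_realpow divide_inverse)
      also have "\<dots> powr \<alpha> = 2 powr (- \<alpha> * j)" by (simp add: powr_powr mult.commute)
      finally have "t powr \<alpha> \<le> 2 powr (- \<alpha> * j)" .
      moreover have "1 / (2 ^ j) ^ m = 2 powr (- real m * j)"
        by (simp add: powr_minus divide_inverse powr_powr mult.commute[of "real m"] flip: power_mult powr_realpow)
      ultimately have "1 / (2 ^ j) ^ m * t powr \<alpha> \<le> 2 powr (- real m * j) * 2 powr (- \<alpha> * j)"
        by (intro mult_mono) auto
      also have "\<dots> = 2 powr (- r * j)" by (simp add: rm algebra_simps flip: powr_add)
      finally have "(4 * s ^ (m + 2) * D) * (1 / (2 ^ j) ^ m * t powr \<alpha>) \<le> (4 * s ^ (m + 2) * D) * 2 powr (- r * j)"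
        using s D(1) by (intro mult_left_mono) auto
      then show "s * A * D * t powr \<alpha> \<le> 4 * s ^ (m + 2) * D * 2 powr (- r * j)"
        by (simp add: A_def mult_ac)
      show "0 \<le> s * A * D * t powr \<alpha>" using s A D(1) by simp
    qed
    finally show ?thesis .
  qed
  moreover have "0 \<le> 4 * s ^ (m + 2) * D" using s D(1) by simp
  ultimately show ?thesis by blast
qed

section \<open>Small divisors of a Diophantine vector\<close>

lemma sum_inverse_squares_le: "(\<Sum>n=1..M. 1 / (real n)\<^sup>2) \<le> 2"
proof -
  have "(\<Sum>n=1..Suc M. 1 / (real n)\<^sup>2) \<le> 2 - 1 / real (Suc M)" for M
  proof (induction M)
    case (Suc M)
    define x where "x = real (Suc M)"
    have x: "x > 0" by (simp add: x_def)
    have "1 / (x + 1)\<^sup>2 \<le> 1 / (x * (x + 1))"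
      using x by (intro divide_left_mono) (auto simp: power2_eq_square)
    also have "\<dots> = 1 / x - 1 / (x + 1)" using x by (simp add: field_simps)
    finally have "1 / (x + 1)\<^sup>2 \<le> 1 / x - 1 / (x + 1)" .
    then show ?case using Suc by (simp add: x_def add.commute)
  qed simp
  from this[of M] have "(\<Sum>n=1..Suc M. 1 / (real n)\<^sup>2) \<le> 2"
    by (rule order_trans) simp
  moreover have "(\<Sum>n=1..M. 1 / (real n)\<^sup>2) \<le> (\<Sum>n=1..Suc M. 1 / (real n)\<^sup>2)"
    by (intro sum_mono2) auto
  ultimately show ?thesis by linarith
qed

text \<open>Rounding down \<open>\<theta> k / \<delta>\<close> assigns distinct positive integers to distinct indices, so the sum
  is dominated by the convergent series of inverse squares of the integers.\<close>

lemma sum_inverse_squares_separated_pos: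
  fixes \<theta> :: "'k \<Rightarrow> real"
  assumes K: "finite K" and \<delta>: "\<delta> > 0"
    and ge: "\<And>k. k \<in> K \<Longrightarrow> \<delta> \<le> \<theta> k"
    and sep: "\<And>k l. k \<in> K \<Longrightarrow> l \<in> K \<Longrightarrow> k \<noteq> l \<Longrightarrow> \<delta> \<le> \<bar>\<theta> k - \<theta> l\<bar>"
  shows "(\<Sum>k\<in>K. 1 / (\<theta> k)\<^sup>2) \<le> 2 / \<delta>\<^sup>2"
proof -
  define n where "n k = nat \<lfloor>\<theta> k / \<delta>\<rfloor>" for k
  have n: "1 \<le> n k" "real (n k) \<le> \<theta> k / \<delta>" "\<theta> k / \<delta> < real (n k) + 1" if "k \<in> K" for k
  proof -
    have "1 \<le> \<theta> k / \<delta>" using ge[OF that] \<delta> by simp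
    then have "1 \<le> \<lfloor>\<theta> k / \<delta>\<rfloor>" by simp
    then show "1 \<le> n k" "real (n k) \<le> \<theta> k / \<delta>" "\<theta> k / \<delta> < real (n k) + 1"
      unfolding n_def by linarith+
  qed
  have "inj_on n K"
  proof (rule inj_onI, rule ccontr)
    fix k l assume kl: "k \<in> K" "l \<in> K" "n k = n l" "k \<noteq> l"
    have "1 \<le> \<bar>\<theta> k - \<theta> l\<bar> / \<delta>" using sep[OF kl(1,2,4)] \<delta> by simp
    also have "\<dots> = \<bar>\<theta> k / \<delta> - \<theta> l / \<delta>\<bar>" using \<delta> by (simp add: abs_divide flip: diff_divide_distrib)
    also have "\<dots> < 1" using n(2,3)[OF kl(1)] n(2,3)[OF kl(2)] kl(3) by auto
    finally show False by simp
  qed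
  have "(\<Sum>k\<in>K. 1 / (\<theta> k)\<^sup>2) \<le> (\<Sum>k\<in>K. 1 / \<delta>\<^sup>2 * (1 / (real (n k))\<^sup>2))"
  proof (rule sum_mono)
    fix k assume k: "k \<in> K"
    have "real (n k) * \<delta> \<le> \<theta> k" using n(2)[OF k] \<delta> by (simp add: field_simps)
    then have "(real (n k) * \<delta>)\<^sup>2 \<le> (\<theta> k)\<^sup>2" using \<delta> by (intro power_mono) auto
    moreover have "0 < real (n k) * \<delta>" using n(1)[OF k] \<delta> by simp
    ultimately have "1 / (\<theta> k)\<^sup>2 \<le> 1 / (real (n k) * \<delta>)\<^sup>2"
      by (intro frac_le zero_less_power) auto
    then show "1 / (\<theta> k)\<^sup>2 \<le> 1 / \<delta>\<^sup>2 * (1 / (real (n k))\<^sup>2)"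
      by (simp add: power_mult_distrib mult.commute)
  qed
  also have "\<dots> = 1 / \<delta>\<^sup>2 * (\<Sum>q\<in>n ` K. 1 / (real q)\<^sup>2)"
    using \<open>inj_on n K\<close> by (simp add: sum.reindex sum_distrib_left)
  also have "(\<Sum>q\<in>n ` K. 1 / (real q)\<^sup>2) \<le> (\<Sum>q=1..Max (insert 0 (n ` K)). 1 / (real q)\<^sup>2)"
    using K n(1) by (intro sum_mono2) auto
  also have "\<dots> \<le> 2" by (rule sum_inverse_squares_le)
  finally show ?thesis by (simp add: divide_right_mono mult_left_mono)
qed

lemma sum_inverse_squares_separated:
  fixes \<theta> :: "'k \<Rightarrow> real"
  assumes K: "finite K" and \<delta>: "\<delta> > 0"
    and ge: "\<And>k. k \<in> K \<Longrightarrow> \<delta> \<le> \<bar>\<theta> k\<bar>"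
    and sep: "\<And>k l. k \<in> K \<Longrightarrow> l \<in> K \<Longrightarrow> k \<noteq> l \<Longrightarrow> \<delta> \<le> \<bar>\<theta> k - \<theta> l\<bar>"
  shows "(\<Sum>k\<in>K. 1 / (\<theta> k)\<^sup>2) \<le> (2 / \<delta>)\<^sup>2"
proof -
  have "K = {k \<in> K. 0 \<le> \<theta> k} \<union> {k \<in> K. \<theta> k < 0}" by auto
  then have "(\<Sum>k\<in>K. 1 / (\<theta> k)\<^sup>2)
      = (\<Sum>k | k \<in> K \<and> 0 \<le> \<theta> k. 1 / (\<theta> k)\<^sup>2) + (\<Sum>k | k \<in> K \<and> \<theta> k < 0. 1 / (\<theta> k)\<^sup>2)"
    using K by (subst sum.union_disjoint[symmetric]) auto
  also have "(\<Sum>k | k \<in> K \<and> 0 \<le> \<theta> k. 1 / (\<theta> k)\<^sup>2) \<le> 2 / \<delta>\<^sup>2"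
    using K \<delta> ge sep by (intro sum_inverse_squares_separated_pos) fastforce+
  also have "(\<Sum>k | k \<in> K \<and> \<theta> k < 0. 1 / (\<theta> k)\<^sup>2) \<le> 2 / \<delta>\<^sup>2"
  proof -
    have "(\<Sum>k | k \<in> K \<and> \<theta> k < 0. 1 / (- \<theta> k)\<^sup>2) \<le> 2 / \<delta>\<^sup>2"
      using K \<delta> ge sep by (intro sum_inverse_squares_separated_pos) (fastforce simp: abs_minus_commute)+
    then show ?thesis by simp
  qed
  finally show ?thesis by (simp add: power_divide)
qed

lemma Diophantine_ge:
  assumes "\<omega> \<in> Diophantine \<nu> \<tau>" "k \<noteq> 0"
  shows "\<nu> * int_norm k powr (- \<tau>) \<le> \<bar>int_pairing k \<omega> - of_int n\<bar>"
  using assms by (simp add: Diophantine_def int_norm_def int_pairing_def)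

text \<open>Dirichlet's theorem for a single coordinate of \<open>\<omega>\<close> produces integers \<open>q \<le> N\<close> whose multiple of it
  is within \<open>1 / N\<close> of an integer, which contradicts an exponent below 1 once \<open>N\<close> is large.\<close>

lemma Diophantine_exponent_ge_1:
  fixes \<omega> :: "real ^ 'n::finite"
  assumes "\<omega> \<in> Diophantine \<nu> \<tau>" "\<nu> > 0"
  shows "1 \<le> \<tau>"
proof (rule ccontr)
  assume "\<not> 1 \<le> \<tau>"
  \<comment> \<open>Covers negative \<open>\<tau>\<close> as well.\<close>
  define \<tau>' where "\<tau>' = max \<tau> 0"
  have \<tau>': "0 \<le> \<tau>'" "\<tau>' < 1" "\<tau> \<le> \<tau>'" using \<open>\<not> 1 \<le> \<tau>\<close> by (auto simp: \<tau>'_def)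
  define i :: 'n where "i = undefined"
  \<comment> \<open>Large enough for \<open>\<nu> * N powr (1 - \<tau>') \<ge> 1\<close>.\<close>
  define N where "N = nat \<lceil>(1 / \<nu>) powr (1 / (1 - \<tau>'))\<rceil> + 1"
  have N: "N > 0" "(1 / \<nu>) powr (1 / (1 - \<tau>')) \<le> real N" unfolding N_def by linarith+
  have "\<exists>q p. 0 < q \<and> q \<le> int N \<and> \<bar>of_int q * \<omega> $ i - of_int p\<bar> < 1 / N"
  proof (rule Dirichlet_approx_simult[OF N(1), of 1 "\<lambda>_. \<omega> $ i"])
    fix q :: int and p :: "nat \<Rightarrow> int"
    assume *: "0 < q" "q \<le> int (N ^ 1)" "\<And>j. j < 1 \<Longrightarrow> \<bar>of_int q * \<omega> $ i - of_int (p j)\<bar> < 1 / N"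
    show ?thesis using *(1,2) *(3)[of 0] by (intro exI[of _ q] exI[of _ "p 0"]) simp
  qed
  then obtain q p where q: "0 < q" "q \<le> int N" "\<bar>of_int q * \<omega> $ i - of_int p\<bar> < 1 / N" by blast
  define k :: "int ^ 'n" where "k = axis i q"
  have "int_norm k = (\<Sum>j\<in>UNIV. if j = i then of_int q else 0)"
    unfolding int_norm_def k_def using q(1) by (intro sum.cong) (auto simp: axis_def)
  then have nk: "int_norm k = of_int q" by simp
  have "int_pairing k \<omega> = (\<Sum>j\<in>UNIV. if j = i then of_int q * \<omega> $ i else 0)"
    unfolding int_pairing_def k_def by (intro sum.cong) (auto simp: axis_def)
  then have pk: "int_pairing k \<omega> = of_int q * \<omega> $ i" by simp
  have "k \<noteq> 0" using q(1) nk int_norm_eq_0_iff[of k] by auto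
  have q1: "1 \<le> real_of_int q" "real_of_int q \<le> real N" using q(1,2) by auto
  have "real N powr (- \<tau>') \<le> of_int q powr (- \<tau>')"
    using q1 \<tau>'(1) by (intro powr_mono2') auto
  also have "\<dots> \<le> of_int q powr (- \<tau>)" using q1 \<tau>'(3) by (intro powr_mono) auto
  finally have "\<nu> * real N powr (- \<tau>') \<le> \<nu> * of_int q powr (- \<tau>)"
    using assms(2) by simp
  also have "\<dots> \<le> \<bar>of_int q * \<omega> $ i - of_int p\<bar>"
    using Diophantine_ge[OF assms(1) \<open>k \<noteq> 0\<close>, of p] by (simp add: nk pk)
  also have "\<dots> < 1 / N" using q(3) by simp
  finally have "\<nu> * real N powr (- \<tau>') * real N < 1" using N(1) by (simp add: field_simps)
  moreover have "real N powr (- \<tau>') * real N = real N powr (1 - \<tau>')"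
    using powr_add[of "real N" "- \<tau>'" 1] N(1) by simp
  ultimately have "\<nu> * real N powr (1 - \<tau>') < 1" by (simp add: mult.assoc)
  moreover have "1 / \<nu> \<le> real N powr (1 - \<tau>')"
    using powr_mono2[OF _ _ N(2), of "1 - \<tau>'"] \<tau>' assms(2) by (simp add: powr_powr)
  ultimately show False using assms(2) by (simp add: field_simps)
qed

lemma Diophantine_character_neq_1:
  assumes "\<omega> \<in> Diophantine \<nu> \<tau>" "\<nu> > 0" "k \<noteq> 0"
  shows "character k \<omega> \<noteq> 1"
proof
  assume "character k \<omega> = 1"
  then have "sin (2 * pi * int_pairing k \<omega>) = sin 0 \<and> cos (2 * pi * int_pairing k \<omega>) = cos 0"
    by (simp add: character_def complex_eq_iff)
  then obtain n :: int where "2 * pi * int_pairing k \<omega> = 0 + 2 * pi * n"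
    unfolding sin_cos_eq_iff by blast
  then have "int_pairing k \<omega> = n" by simp
  moreover have "0 < \<nu> * int_norm k powr (- \<tau>)" using assms int_norm_ge_1[of k] by auto
  ultimately show False using Diophantine_ge[OF assms(1,3), of n] by simp
qed

text \<open>The divisor at \<open>k\<close> is at least the distance \<open>\<bar>\<theta> k\<bar>\<close> of \<open>k \<cdot> \<omega>\<close> to the nearest integer.  Applied to \<open>k\<close>
  and to differences \<open>k - l\<close>, the Diophantine condition keeps the \<open>\<theta> k\<close> away from 0 and from each other
  by the same \<open>\<delta>\<close>.\<close>

lemma small_divisor_square_sum:
  fixes \<omega> :: "real ^ 'n::finite"
  assumes \<omega>: "\<omega> \<in> Diophantine \<nu> \<tau>" and \<nu>: "\<nu> > 0" and \<tau>: "0 \<le> \<tau>"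
  shows "(\<Sum>k\<in>dyadic_block j. (1 / norm (character k \<omega> - 1))\<^sup>2)
    \<le> (2 * 4 powr \<tau> / \<nu> * 2 powr (\<tau> * j))\<^sup>2"
proof -
  let ?B = "dyadic_block j :: (int ^ 'n) set"
  \<comment> \<open>The signed distance to the nearest integer.\<close>
  define \<theta> where "\<theta> k = int_pairing k \<omega> - round (int_pairing k \<omega>)" for k
  \<comment> \<open>The difference of two vectors in the block has norm below \<open>2 ^ (j + 2)\<close>.\<close>
  define \<delta> where "\<delta> = \<nu> * (2 ^ (j + 2)) powr (- \<tau>)"
  have \<delta>: "\<delta> > 0" using \<nu> by (simp add: \<delta>_def)
  have far: "\<delta> \<le> \<bar>int_pairing k \<omega> - of_int n\<bar>" if "k \<noteq> 0" "int_norm k \<le> 2 ^ (j + 2)" for k n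
  proof -
    have "(2 ^ (j + 2)) powr (- \<tau>) \<le> int_norm k powr (- \<tau>)"
      using that int_norm_ge_1[of k] \<tau> by (intro powr_mono2') auto
    then have "\<delta> \<le> \<nu> * int_norm k powr (- \<tau>)" using \<nu> by (simp add: \<delta>_def)
    then show ?thesis using Diophantine_ge[OF \<omega> that(1), of n] by linarith
  qed
  have ge: "\<delta> \<le> \<bar>\<theta> k\<bar>" if "k \<in> ?B" for k
  proof -
    have "int_norm k \<le> 2 ^ (j + 2)" using that by (simp add: dyadic_block_def)
    moreover have "k \<noteq> 0" using that zero_notin_dyadic_block by metis
    ultimately show ?thesis unfolding \<theta>_def by (intro far) auto
  qed
  have sep: "\<delta> \<le> \<bar>\<theta> k - \<theta> l\<bar>" if "k \<in> ?B" "l \<in> ?B" "k \<noteq> l" for k l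
  proof -
    have "int_norm (k - l) \<le> 2 ^ (j + 2)"
      using int_norm_diff_le[of k l] that by (simp add: dyadic_block_def)
    then have "\<delta> \<le> \<bar>int_pairing (k - l) \<omega> - of_int (round (int_pairing k \<omega>) - round (int_pairing l \<omega>))\<bar>"
      using that by (intro far) auto
    then show ?thesis by (simp add: \<theta>_def int_pairing_diff_left algebra_simps)
  qed
  have "(\<Sum>k\<in>?B. (1 / norm (character k \<omega> - 1))\<^sup>2) \<le> (\<Sum>k\<in>?B. 1 / (\<theta> k)\<^sup>2)"
  proof (rule sum_mono)
    fix k assume k: "k \<in> ?B"
    have "character k \<omega> = cis (2 * pi * \<theta> k) * cis (2 * pi * of_int (round (int_pairing k \<omega>)))"
      by (simp add: character_def \<theta>_def cis_mult algebra_simps)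
    then have "character k \<omega> = cis (2 * pi * \<theta> k)" by (simp add: cis_multiple_2pi)
    moreover have "\<bar>\<theta> k\<bar> \<le> 1 / 2"
      using of_int_round_abs_le[of "int_pairing k \<omega>"] by (simp add: \<theta>_def abs_minus_commute)
    ultimately have "\<bar>\<theta> k\<bar> \<le> norm (character k \<omega> - 1)" using norm_cis_minus_1_ge by metis
    moreover have "0 < \<bar>\<theta> k\<bar>" using ge[OF k] \<delta> by linarith
    ultimately have "1 / norm (character k \<omega> - 1) \<le> 1 / \<bar>\<theta> k\<bar>" by (intro divide_left_mono mult_pos_pos) auto
    then have "(1 / norm (character k \<omega> - 1))\<^sup>2 \<le> (1 / \<bar>\<theta> k\<bar>)\<^sup>2" by (intro power_mono) auto
    then show "(1 / norm (character k \<omega> - 1))\<^sup>2 \<le> 1 / (\<theta> k)\<^sup>2" by (simp add: power_divide)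
  qed
  also have "\<dots> \<le> (2 / \<delta>)\<^sup>2" using ge sep by (intro sum_inverse_squares_separated finite_dyadic_block \<delta>)
  also have "2 / \<delta> = 2 * 4 powr \<tau> / \<nu> * 2 powr (\<tau> * j)"
  proof -
    have "(2 ^ (j + 2) :: real) powr \<tau> = 4 powr \<tau> * (2 ^ j) powr \<tau>" by (simp add: powr_mult)
    also have "(2 ^ j :: real) powr \<tau> = 2 powr (\<tau> * j)"
      by (simp add: powr_powr mult.commute flip: powr_realpow)
    finally show ?thesis by (simp add: \<delta>_def powr_minus field_simps)
  qed
  finally show ?thesis .
qed

section \<open>Regularity of trigonometric series with decaying blocks\<close>

text \<open>Summing by blocks makes this an ordinary series of trigonometric polynomials without constant term.\<close>

definition block_series :: "(int ^ 'n::finite \<Rightarrow> complex) \<Rightarrow> real ^ 'n \<Rightarrow> complex" where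
  "block_series c x = (\<Sum>j. \<Sum>k\<in>dyadic_block j. c k * character k x)"

text \<open>The substitute for the class \<open>\<rho>\<close> on the Fourier side.\<close>

definition block_decay :: "real \<Rightarrow> (int ^ 'n::finite \<Rightarrow> complex) \<Rightarrow> bool" where
  "block_decay \<rho> c \<longleftrightarrow> (\<exists>C\<ge>0. \<forall>j. (\<Sum>k\<in>dyadic_block j. norm (c k)) \<le> C * 2 powr (- \<rho> * j))"

lemma powr_minus_nat: "2 powr (- \<rho> * real j) = (2 powr (- \<rho>)) ^ j"
  by (simp add: powr_powr flip: powr_realpow)

lemma summable_powr_minus: "0 < \<rho> \<Longrightarrow> summable (\<lambda>j. C * 2 powr (- \<rho> * real j))"
  unfolding powr_minus_nat by (intro summable_mult summable_geometric) (simp add: powr_less_one)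

lemma block_decay_mono:
  assumes "block_decay \<rho> c" "\<rho>' \<le> \<rho>" shows "block_decay \<rho>' c"
proof -
  obtain C where C: "C \<ge> 0" "\<And>j. (\<Sum>k\<in>dyadic_block j. norm (c k)) \<le> C * 2 powr (- \<rho> * j)"
    using assms(1) unfolding block_decay_def by blast
  have "C * 2 powr (- \<rho> * real j) \<le> C * 2 powr (- \<rho>' * real j)" for j
    using C(1) assms(2) by (intro mult_left_mono powr_mono mult_right_mono) auto
  then show ?thesis unfolding block_decay_def using C order_trans by blast
qed

lemma norm_block_le: "norm (\<Sum>k\<in>dyadic_block j. c k * character k x) \<le> (\<Sum>k\<in>dyadic_block j. norm (c k))"
  by (rule order_trans[OF norm_sum]) (simp add: norm_mult)

context
  fixes c :: "int ^ 'n::finite \<Rightarrow> complex" and \<rho> :: real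
  assumes c: "block_decay \<rho> c" and \<rho>: "0 < \<rho>"
begin

lemma block_series_uniform_limit:
  "uniform_limit UNIV (\<lambda>n x. \<Sum>j<n. \<Sum>k\<in>dyadic_block j. c k * character k x) (block_series c) sequentially"
proof -
  obtain C where C: "\<And>j. (\<Sum>k\<in>dyadic_block j. norm (c k)) \<le> C * 2 powr (- \<rho> * j)"
    using c unfolding block_decay_def by blast
  show ?thesis
    unfolding block_series_def[abs_def]
    by (rule Weierstrass_m_test[OF order_trans[OF norm_block_le C] summable_powr_minus[OF \<rho>]])
qed

lemma block_series_sums:
  "(\<lambda>j. \<Sum>k\<in>dyadic_block j. c k * character k x) sums block_series c x"
  unfolding sums_def by (rule tendsto_uniform_limitI[OF block_series_uniform_limit UNIV_I])

lemma continuous_on_block_series: "continuous_on S (block_series c)"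
proof -
  have "continuous_on UNIV (block_series c)"
    by (rule uniform_limit_theorem[OF _ block_series_uniform_limit])
      (auto intro!: continuous_intros always_eventually)
  then show ?thesis by (rule continuous_on_subset) simp
qed

text \<open>Uniform convergence allows to compute the coefficients block by block, and \<open>l\<close> lies in exactly one
  block unless it is 0.\<close>

lemma fourier_block_series: "fourier (block_series c) l = (if l = 0 then 0 else c l)"
proof -
  let ?S = "\<lambda>n x. \<Sum>j<n. \<Sum>k\<in>dyadic_block j. c k * character k x"
  let ?f = "\<lambda>n x. character (- l) x * ?S n x"
  have "uniform_limit (cbox 0 1) ?f (\<lambda>x. character (- l) x * block_series c x) sequentially"
  proof (rule uniform_limitI)
    fix e :: real assume "0 < e"
    then have "\<forall>\<^sub>F n in sequentially. \<forall>x\<in>UNIV. dist (?S n x) (block_series c x) < e"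
      using block_series_uniform_limit unfolding uniform_limit_iff by blast
    then show "\<forall>\<^sub>F n in sequentially. \<forall>x\<in>cbox 0 1. dist (?f n x) (character (- l) x * block_series c x) < e"
      by eventually_elim (simp add: dist_norm norm_mult flip: right_diff_distrib)
  qed
  moreover have "continuous_on (cbox 0 1) (?f n)" for n by (intro continuous_intros)
  ultimately have lim: "(\<lambda>n. fourier (?S n) l) \<longlonglongrightarrow> fourier (block_series c) l"
  proof (rule uniform_limit_integral_cbox)
    fix I J
    assume "\<And>n. (?f n has_integral I n) (cbox 0 1)" "I \<longlonglongrightarrow> J"
      "((\<lambda>x. character (- l) x * block_series c x) has_integral J) (cbox 0 1)"
    then have "I n = fourier (?S n) l" "J = fourier (block_series c) l" for n
      unfolding fourier_def torus_mean_def by (blast intro: integral_unique[symmetric])+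
    then have "I = (\<lambda>n. fourier (?S n) l)" "J = fourier (block_series c) l" by (simp_all add: fun_eq_iff)
    then show "(\<lambda>n. fourier (?S n) l) \<longlonglongrightarrow> fourier (block_series c) l"
      using \<open>I \<longlonglongrightarrow> J\<close> by simp
  qed simp
  have part: "fourier (\<lambda>x. \<Sum>k\<in>B. c k * character k x) l = (if l \<in> B then c l else 0)" if "finite B" for B
    using that
  proof (induction B rule: finite_induct)
    case empty
    then show ?case using fourier_mult_left[of 0 "\<lambda>_. 0" l] by simp
  next
    case (insert k B)
    have "fourier (\<lambda>x. \<Sum>k\<in>insert k B. c k * character k x) l
        = fourier (\<lambda>x. c k * character k x + (\<Sum>k\<in>B. c k * character k x)) l"
      using insert by simp
    also have "\<dots> = (if l \<in> insert k B then c l else 0)"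
      using insert by (subst fourier_add)
        (auto intro!: continuous_intros simp: fourier_mult_left fourier_character)
    finally show ?case .
  qed
  have S: "fourier (?S n) l = (\<Sum>j<n. if l \<in> dyadic_block j then c l else 0)" for n
  proof (induction n)
    case 0
    then show ?case using fourier_mult_left[of 0 "\<lambda>_. 0" l] by simp
  next
    case (Suc n)
    have "fourier (?S (Suc n)) l = fourier (\<lambda>x. ?S n x + (\<Sum>k\<in>dyadic_block n. c k * character k x)) l"
      by simp
    also have "\<dots> = fourier (?S n) l + fourier (\<lambda>x. \<Sum>k\<in>dyadic_block n. c k * character k x) l"
      by (intro fourier_add continuous_intros)
    finally show ?case using Suc part[OF finite_dyadic_block] by simp
  qed
  have "(\<lambda>j. if l \<in> dyadic_block j then c l else 0) sums (if l = 0 then 0 else c l)"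
  proof (cases "l = 0")
    case True
    then show ?thesis by (simp add: zero_notin_dyadic_block)
  next
    case False
    then show ?thesis
      using sums_single[of "nat \<lfloor>log 2 (int_norm l)\<rfloor>" "\<lambda>_. c l"] by (simp add: mem_dyadic_block_iff)
  qed
  then have "(\<lambda>n. fourier (?S n) l) \<longlonglongrightarrow> (if l = 0 then 0 else c l)" unfolding sums_def S .
  then show ?thesis using lim LIMSEQ_unique by blast
qed

end

lemma periodic_block_series: "periodic (block_series c)"
  unfolding periodic_def
proof (intro allI impI)
  fix x y :: "real ^ 'a" assume "torus_proj x = torus_proj y"
  then have "character k x = character k y" for k
    using periodic_character[of k] unfolding periodic_def by blast
  then show "block_series c x = block_series c y" by (simp add: block_series_def)
qed

lemma block_decay_derivative:
  assumes "block_decay \<rho> c"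
  shows "block_decay (\<rho> - 1) (\<lambda>k. 2 * pi * \<i> * of_int (k $ i) * c k)"
proof -
  obtain C where C: "C \<ge> 0" "\<And>j. (\<Sum>k\<in>dyadic_block j. norm (c k)) \<le> C * 2 powr (- \<rho> * j)"
    using assms unfolding block_decay_def by blast
  have "(\<Sum>k\<in>dyadic_block j. norm (2 * pi * \<i> * of_int (k $ i) * c k)) \<le> 4 * pi * C * 2 powr (- (\<rho> - 1) * j)" for j
  proof -
    have "(\<Sum>k\<in>dyadic_block j. norm (2 * pi * \<i> * of_int (k $ i) * c k))
        \<le> (\<Sum>k\<in>dyadic_block j. 2 * pi * 2 ^ Suc j * norm (c k))"
    proof (intro sum_mono)
      fix k :: "int ^ 'a" assume "k \<in> dyadic_block j"
      then have "\<bar>real_of_int (k $ i)\<bar> \<le> 2 ^ Suc j"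
        using int_norm_component[of k i] by (simp add: dyadic_block_def)
      then have "2 * pi * \<bar>real_of_int (k $ i)\<bar> * norm (c k) \<le> 2 * pi * 2 ^ Suc j * norm (c k)"
        by (intro mult_right_mono mult_left_mono) auto
      then show "norm (2 * pi * \<i> * of_int (k $ i) * c k) \<le> 2 * pi * 2 ^ Suc j * norm (c k)"
        by (simp add: norm_mult)
    qed
    also have "\<dots> = 2 * pi * 2 ^ Suc j * (\<Sum>k\<in>dyadic_block j. norm (c k))"
      by (simp add: sum_distrib_left)
    also have "\<dots> \<le> 2 * pi * 2 ^ Suc j * (C * 2 powr (- \<rho> * j))"
      by (intro mult_left_mono C) simp
    also have "\<dots> = 4 * pi * C * (2 powr j * 2 powr (- \<rho> * j))" by (simp add: powr_realpow)
    also have "\<dots> = 4 * pi * C * 2 powr (- (\<rho> - 1) * j)" by (simp add: algebra_simps flip: powr_add)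
    finally show ?thesis .
  qed
  then show ?thesis using C(1) unfolding block_decay_def by (intro exI[of _ "4 * pi * C"]) simp
qed

lemma int_pairing_abs_le: "\<bar>int_pairing k x\<bar> \<le> int_norm k * norm x"
proof -
  have "\<bar>int_pairing k x\<bar> \<le> (\<Sum>i\<in>UNIV. \<bar>of_int (k $ i)\<bar> * norm x)"
    unfolding int_pairing_def
    by (rule order_trans[OF sum_abs]) (auto simp: abs_mult intro!: sum_mono mult_left_mono component_le_norm_cart)
  then show ?thesis by (simp add: int_norm_def sum_distrib_right)
qed

text \<open>Each partial derivative of the series is again a block series, of decay \<open>\<rho> - 1 > 0\<close> and hence
  uniformly convergent, which justifies differentiation term by term.\<close>

lemma block_series_has_derivative:
  assumes c: "block_decay \<rho> c" and \<rho>: "1 < \<rho>"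
  shows "(block_series c has_derivative
    (\<lambda>h. \<Sum>i\<in>UNIV. h $ i *\<^sub>R block_series (\<lambda>k. 2 * pi * \<i> * of_int (k $ i) * c k) x)) (at x)"
proof -
  define d where "d i k = 2 * pi * \<i> * of_int (k $ i) * c k" for i k
  have d: "block_decay (\<rho> - 1) (d i)" for i
    unfolding d_def[abs_def] using c by (rule block_decay_derivative)
  have \<rho>': "0 < \<rho> - 1" "0 < \<rho>" using \<rho> by auto
  let ?P = "\<lambda>c j x. \<Sum>k\<in>dyadic_block j. c k * character k x"
  let ?f' = "\<lambda>j x h. \<Sum>i\<in>UNIV. h $ i *\<^sub>R ?P (d i) j x"
  have der: "(?P c j has_derivative ?f' j x) (at x)" for j x
  proof -
    have "(?P c j has_derivative (\<lambda>h. \<Sum>k\<in>dyadic_block j. c k *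
        ((\<i> * of_real (2 * pi * int_pairing k h)) * character k x))) (at x)"
      by (intro has_derivative_sum has_derivative_mult_right character_has_derivative)
    moreover have "(\<Sum>k\<in>dyadic_block j. c k * ((\<i> * of_real (2 * pi * int_pairing k h)) * character k x)) = ?f' j x h" for h
      unfolding d_def int_pairing_def scaleR_sum_right
      by (subst sum.swap) (simp add: sum_distrib_left sum_distrib_right scaleR_conv_of_real mult_ac)
    ultimately show ?thesis by simp
  qed
  have unif: "\<forall>\<^sub>F n in sequentially. \<forall>x\<in>UNIV. \<forall>h. norm (sum (\<lambda>j. ?f' j x h) {..<n}
      - (\<Sum>i\<in>UNIV. h $ i *\<^sub>R block_series (d i) x)) \<le> e * norm h" if "e > 0" for e
  proof -
    define e' where "e' = e / CARD('a)"
    have e': "e' > 0" using that by (simp add: e'_def)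
    have "\<forall>\<^sub>F n in sequentially. \<forall>x. dist (\<Sum>j<n. ?P (d i) j x) (block_series (d i) x) < e'" for i
      using block_series_uniform_limit[OF d \<rho>'(1)] e' unfolding uniform_limit_iff by auto
    then have "\<forall>\<^sub>F n in sequentially. \<forall>i\<in>UNIV. \<forall>x. dist (\<Sum>j<n. ?P (d i) j x) (block_series (d i) x) < e'"
      by (intro eventually_ball_finite) auto
    then show ?thesis
    proof eventually_elim
      case (elim n)
      show ?case
      proof (intro ballI allI)
        fix x h
        have "sum (\<lambda>j. ?f' j x h) {..<n} - (\<Sum>i\<in>UNIV. h $ i *\<^sub>R block_series (d i) x)
            = (\<Sum>i\<in>UNIV. h $ i *\<^sub>R ((\<Sum>j<n. ?P (d i) j x) - block_series (d i) x))"
          by (subst sum.swap) (simp add: scaleR_diff_right sum_subtractf flip: scaleR_sum_right)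
        also have "norm \<dots> \<le> (\<Sum>i\<in>(UNIV :: 'a set). norm h * e')"
        proof (rule order_trans[OF norm_sum sum_mono])
          fix i
          have "norm ((\<Sum>j<n. ?P (d i) j x) - block_series (d i) x) \<le> e'"
            using elim by (simp add: dist_norm less_imp_le)
          then show "norm (h $ i *\<^sub>R ((\<Sum>j<n. ?P (d i) j x) - block_series (d i) x)) \<le> norm h * e'"
            unfolding norm_scaleR using component_le_norm_cart[of h i] by (intro mult_mono) auto
        qed
        also have "\<dots> = e * norm h" by (simp add: e'_def)
        finally show "norm (sum (\<lambda>j. ?f' j x h) {..<n} - (\<Sum>i\<in>UNIV. h $ i *\<^sub>R block_series (d i) x)) \<le> e * norm h" .
      qed
    qed
  qed
  obtain g where g: "\<And>x. (\<lambda>j. ?P c j x) sums g x"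
      "\<And>x. (g has_derivative (\<lambda>h. \<Sum>i\<in>UNIV. h $ i *\<^sub>R block_series (d i) x)) (at x)"
    using has_derivative_series[OF convex_UNIV, of "?P c" ?f', OF _ unif UNIV_I block_series_sums[OF c \<rho>'(2)]] der
    by auto
  have "g = block_series c" using g(1) block_series_sums[OF c \<rho>'(2)] sums_unique2 by blast
  then show ?thesis using g(2) unfolding d_def[abs_def] by simp
qed

lemma sum_axis_scaleR:
  "(\<Sum>i\<in>UNIV. axis l 1 $ i *\<^sub>R (y i :: complex)) = y l"
proof -
  have "(\<Sum>i\<in>UNIV. axis l 1 $ i *\<^sub>R y i) = (\<Sum>i\<in>UNIV. if i = l then y l else 0)"
    by (intro sum.cong) (auto simp: axis_def)
  then show ?thesis by simp
qed

lemma norm_character_diff_le: "norm (character k x - character k y) \<le> 2 * pi * int_norm k * norm (x - y)"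
proof -
  have "norm (cis \<theta> - 1) \<le> \<bar>\<theta>\<bar>" for \<theta>
    using dist_exp_i_1[of \<theta>] abs_sin_x_le_abs_x[of "\<theta> / 2"] by (simp add: cis_conv_exp)
  then have "norm (character k (x - y) - 1) \<le> \<bar>2 * pi * int_pairing k (x - y)\<bar>"
    by (simp add: character_def)
  also have "\<dots> \<le> 2 * pi * (int_norm k * norm (x - y))"
    using int_pairing_abs_le by (simp add: abs_mult)
  also have "norm (character k (x - y) - 1) = norm (character k x - character k y)"
  proof -
    have "character k x - character k y = (character k (x - y) - 1) * character k y"
      using character_add[of k "x - y" y] by (simp add: algebra_simps)
    then show ?thesis by (simp add: norm_mult)
  qed
  finally show ?thesis by (simp add: mult.assoc)
qed

text \<open>Let \<open>N\<close> be the first index with \<open>2 powr (- N) \<le> d\<close>.  The summands are bounded by a growing geometric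
  sequence before \<open>N\<close>, as \<open>\<beta> < 1\<close>, and by a decaying one after it, as \<open>\<beta> > 0\<close>.  Both parts are dominated by
  their terms near \<open>N\<close>, which are of order \<open>d powr \<beta>\<close>.\<close>

lemma sum_dyadic_min_le:
  assumes \<beta>: "0 < \<beta>" "\<beta> < 1"
  obtains C where "C \<ge> 0" "\<And>d n. 0 < d \<Longrightarrow> (\<Sum>j<n. 2 powr (- \<beta> * real j) * min 1 (2 ^ j * d)) \<le> C * d powr \<beta>"
proof -
  define a where "a = 2 powr (1 - \<beta>)"
  define b where "b = 2 powr (- \<beta>)"
  have a: "a > 1" using \<beta> by (simp add: a_def)
  have b: "0 < b" "b < 1" using \<beta> by (auto simp: b_def powr_less_one)
  have tail: "(\<Sum>j\<in>{N..<n}. 2 powr (- \<beta> * real j)) \<le> b ^ N / (1 - b)" for N n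
  proof -
    have "(\<Sum>j\<in>{N..<n}. 2 powr (- \<beta> * real j)) = (\<Sum>j\<in>{N..<n}. b ^ j)"
      unfolding powr_minus_nat b_def ..
    also have "\<dots> = b ^ N * (\<Sum>j<n - N. b ^ j)"
      unfolding sum.atLeastLessThan_shift_0[of _ N n]
      by (simp add: sum_distrib_left power_add atLeast0LessThan)
    also have "\<dots> \<le> b ^ N * (1 / (1 - b))"
    proof -
      have "(\<Sum>j<n - N. b ^ j) * (1 - b) = 1 - b ^ (n - N)"
        using one_diff_power_eq[of b "n - N"] by (simp add: mult.commute)
      also have "\<dots> \<le> 1" using b by simp
      finally have "(\<Sum>j<n - N. b ^ j) \<le> 1 / (1 - b)" using b by (simp add: pos_le_divide_eq)
      then show ?thesis using b by (intro mult_left_mono) auto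
    qed
    also have "b ^ N * (1 / (1 - b)) = b ^ N / (1 - b)" by simp
    finally show ?thesis .
  qed
  have head: "(\<Sum>j<N. 2 powr (- \<beta> * real j) * 2 ^ j) \<le> a ^ N / (a - 1)" for N
  proof -
    have "2 powr (- \<beta> * real j) * 2 ^ j = a ^ j" for j
      by (simp add: a_def powr_powr powr_realpow[symmetric] algebra_simps flip: powr_add)
    then have "(\<Sum>j<N. 2 powr (- \<beta> * real j) * 2 ^ j) = (a ^ N - 1) / (a - 1)"
      using a by (simp add: geometric_sum)
    then show ?thesis using a by (simp add: divide_right_mono)
  qed
  define C where "C = 1 / (1 - b) + a / (a - 1)"
  have C: "C \<ge> 0" using a b by (simp add: C_def)
  have "(\<Sum>j<n. 2 powr (- \<beta> * real j) * min 1 (2 ^ j * d)) \<le> C * d powr \<beta>" if d: "0 < d" for d n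
  proof -
    \<comment> \<open>For \<open>d \<ge> 1\<close> this is 0, and only the decaying part is left.\<close>
    define N where "N = nat \<lceil>- log 2 d\<rceil>"
    have N: "- log 2 d \<le> N" "d < 1 \<Longrightarrow> real N < 1 - log 2 d"
    proof -
      show "- log 2 d \<le> N" unfolding N_def by linarith
      assume "d < 1"
      then have "0 < - log 2 d" using d by simp
      then show "real N < 1 - log 2 d" unfolding N_def by linarith
    qed
    have bN: "b ^ N \<le> d powr \<beta>"
    proof -
      have "b ^ N = 2 powr (- \<beta> * N)" unfolding powr_minus_nat b_def ..
      also have "\<dots> \<le> 2 powr (\<beta> * log 2 d)"
        using mult_left_mono[OF N(1), of \<beta>] \<beta> by (intro powr_mono) auto
      also have "\<dots> = d powr \<beta>" using d powr_powr[of 2 "log 2 d" \<beta>] by (simp add: mult.commute)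
      finally show ?thesis .
    qed
    have aN: "a ^ N * d \<le> a * d powr \<beta>" if "d < 1"
    proof -
      have "a ^ N = 2 powr ((1 - \<beta>) * N)" by (simp add: a_def powr_powr flip: powr_realpow)
      also have "\<dots> \<le> 2 powr ((1 - \<beta>) * (1 - log 2 d))"
        using N(2)[OF that] \<beta> by (intro powr_mono mult_left_mono) auto
      also have "\<dots> = a * 2 powr (log 2 d * (\<beta> - 1))"
        by (simp add: a_def algebra_simps flip: powr_add)
      also have "\<dots> = a * d powr (\<beta> - 1)" using d powr_powr[of 2 "log 2 d" "\<beta> - 1"] by simp
      finally have "a ^ N * d \<le> a * d powr (\<beta> - 1) * d" using d by (intro mult_right_mono) auto
      also have "\<dots> = a * d powr \<beta>" using d powr_add[of d "\<beta> - 1" 1] by simp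
      finally show ?thesis .
    qed
    have headN: "(\<Sum>j<N. 2 powr (- \<beta> * real j) * 2 ^ j) * d \<le> a / (a - 1) * d powr \<beta>"
    proof (cases "d < 1")
      case True
      have "(\<Sum>j<N. 2 powr (- \<beta> * real j) * 2 ^ j) * d \<le> a ^ N / (a - 1) * d"
        using head d by (intro mult_right_mono) auto
      also have "\<dots> = a ^ N * d / (a - 1)" by simp
      also have "\<dots> \<le> a * d powr \<beta> / (a - 1)"
        using aN[OF True] a by (intro divide_right_mono) auto
      finally show ?thesis by simp
    next
      case False
      then have "N = 0" using d by (simp add: N_def)
      then show ?thesis using a by simp
    qed
    let ?t = "\<lambda>j. 2 powr (- \<beta> * real j) * min 1 (2 ^ j * d)"
    have "(\<Sum>j<n. ?t j) \<le> (\<Sum>j\<in>{..<N} \<union> {N..<n}. ?t j)"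
      using d by (intro sum_mono2) auto
    also have "\<dots> = (\<Sum>j<N. ?t j) + (\<Sum>j\<in>{N..<n}. ?t j)"
      by (intro sum.union_disjoint) auto
    also have "\<dots> \<le> (\<Sum>j<N. 2 powr (- \<beta> * real j) * 2 ^ j * d) + (\<Sum>j\<in>{N..<n}. 2 powr (- \<beta> * real j))"
      by (intro add_mono sum_mono) (auto simp: mult.assoc intro!: mult_left_mono mult_left_le)
    also have "\<dots> \<le> a / (a - 1) * d powr \<beta> + d powr \<beta> / (1 - b)"
      using headN order_trans[OF tail divide_right_mono[OF bN]] b
      by (intro add_mono) (auto simp: sum_distrib_right)
    also have "\<dots> = C * d powr \<beta>" by (simp add: C_def algebra_simps)
    finally show ?thesis .
  qed
  then show thesis using that C by blast
qed

text \<open>The difference of the values of a block at two points at distance \<open>d\<close> is bounded by the size of the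
  block and, with a further factor \<open>2 ^ j * d\<close>, by its slope.\<close>

lemma block_series_Hoelder:
  assumes c: "block_decay \<beta> c" and \<beta>: "0 < \<beta>" "\<beta> < 1"
  shows "locally_Hoelder \<beta> (block_series c)"
proof -
  obtain C where C: "C \<ge> 0" "\<And>j. (\<Sum>k\<in>dyadic_block j. norm (c k)) \<le> C * 2 powr (- \<beta> * j)"
    using c unfolding block_decay_def by blast
  obtain D where D: "D \<ge> 0" "\<And>d n. 0 < d \<Longrightarrow> (\<Sum>j<n. 2 powr (- \<beta> * real j) * min 1 (2 ^ j * d)) \<le> D * d powr \<beta>"
    using sum_dyadic_min_le[OF \<beta>] by blast
  have "norm (block_series c x - block_series c y) \<le> 4 * pi * C * D * norm (x - y) powr \<beta>" for x y
  proof (cases "x = y")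
    case False
    define d where "d = norm (x - y)"
    have d: "0 < d" using False by (simp add: d_def)
    let ?P = "\<lambda>x j. \<Sum>k\<in>dyadic_block j. c k * character k x"
    have part: "norm (?P x j - ?P y j) \<le> 4 * pi * C * (2 powr (- \<beta> * j) * min 1 (2 ^ j * d))" for j
    proof -
      have "norm (?P x j - ?P y j) = norm (\<Sum>k\<in>dyadic_block j. c k * (character k x - character k y))"
        by (simp add: sum_subtractf right_diff_distrib)
      also have "\<dots> \<le> (\<Sum>k\<in>dyadic_block j. norm (c k) * (4 * pi * min 1 (2 ^ j * d)))"
      proof (rule order_trans[OF norm_sum sum_mono])
        fix k :: "int ^ 'a" assume k: "k \<in> dyadic_block j"
        have "norm (character k x - character k y) \<le> 2"
          using norm_triangle_ineq4[of "character k x" "character k y"] by simp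
        then have "norm (character k x - character k y) \<le> 4 * pi * 1" using pi_ge_two by linarith
        moreover have "norm (character k x - character k y) \<le> 4 * pi * (2 ^ j * d)"
        proof -
          have "norm (character k x - character k y) \<le> 2 * pi * int_norm k * d"
            unfolding d_def by (rule norm_character_diff_le)
          also have "\<dots> \<le> 2 * pi * 2 ^ Suc j * d"
            using k d by (intro mult_right_mono mult_left_mono) (auto simp: dyadic_block_def)
          finally show ?thesis by simp
        qed
        ultimately have "norm (character k x - character k y) \<le> 4 * pi * min 1 (2 ^ j * d)"
          by (simp add: min_def)
        then show "norm (c k * (character k x - character k y)) \<le> norm (c k) * (4 * pi * min 1 (2 ^ j * d))"
          unfolding norm_mult by (rule mult_left_mono) simp
      qed
      also have "\<dots> = (\<Sum>k\<in>dyadic_block j. norm (c k)) * (4 * pi * min 1 (2 ^ j * d))"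
        by (simp add: sum_distrib_right)
      also have "\<dots> \<le> C * 2 powr (- \<beta> * j) * (4 * pi * min 1 (2 ^ j * d))"
        using d by (intro mult_right_mono C) auto
      finally show ?thesis by (simp add: mult_ac)
    qed
    have "(\<lambda>n. norm (\<Sum>j<n. ?P x j - ?P y j)) \<longlonglongrightarrow> norm (block_series c x - block_series c y)"
      using sums_diff[OF block_series_sums[OF c \<beta>(1), of x] block_series_sums[OF c \<beta>(1), of y]]
      unfolding sums_def by (rule tendsto_norm)
    moreover have "norm (\<Sum>j<n. ?P x j - ?P y j) \<le> 4 * pi * C * D * d powr \<beta>" for n
    proof -
      have "norm (\<Sum>j<n. ?P x j - ?P y j) \<le> (\<Sum>j<n. 4 * pi * C * (2 powr (- \<beta> * j) * min 1 (2 ^ j * d)))"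
        by (rule order_trans[OF norm_sum sum_mono]) (rule part)
      also have "\<dots> = 4 * pi * C * (\<Sum>j<n. 2 powr (- \<beta> * j) * min 1 (2 ^ j * d))"
        by (simp add: sum_distrib_left)
      also have "\<dots> \<le> 4 * pi * C * (D * d powr \<beta>)" using C(1) D(2)[OF d] by (intro mult_left_mono) auto
      finally show ?thesis by (simp add: mult.assoc)
    qed
    ultimately show ?thesis unfolding d_def by (intro Lim_bounded) auto
  qed simp
  then show ?thesis unfolding locally_Hoelder_def by blast
qed

theorem block_series_C_k_alpha:
  assumes "block_decay (m + \<beta>) c" and \<beta>: "0 < \<beta>" "\<beta> < 1"
  shows "C_k_alpha m \<beta> (block_series c)"
  using assms(1)
proof (induction m arbitrary: c)
  case 0
  then show ?case
    using block_series_Hoelder[of \<beta> c] continuous_on_block_series[of \<beta> c] \<beta> by simp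
next
  case (Suc m)
  show ?case
  proof (rule C_k_alpha_SucI)
    show "(block_series c has_derivative
      (\<lambda>h. \<Sum>i\<in>UNIV. h $ i *\<^sub>R block_series (\<lambda>k. 2 * pi * \<i> * of_int (k $ i) * c k) x)) (at x)" for x
      using Suc.prems \<beta> by (intro block_series_has_derivative[where \<rho> = "Suc m + \<beta>"]) auto
    fix e :: "real ^ 'a" assume "e \<in> Basis"
    then obtain l where e: "e = axis l 1" by (auto simp: Basis_vec_def)
    show "C_k_alpha m \<beta> (\<lambda>x. \<Sum>i\<in>UNIV. e $ i *\<^sub>R block_series (\<lambda>k. 2 * pi * \<i> * of_int (k $ i) * c k) x)"
      unfolding e sum_axis_scaleR
      using block_decay_derivative[OF Suc.prems, of l] by (intro Suc.IH) simp
  qed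
qed

text \<open>For integer \<open>\<rho>'\<close> the class asks for no more than a slightly larger non-integer exponent gives.\<close>

theorem block_series_C_class:
  assumes c: "block_decay \<rho> c" and \<rho>: "0 < \<rho>"
    and \<rho>': "0 < \<rho>'" "\<rho>' < \<rho> \<or> \<rho>' = \<rho> \<and> \<rho> \<notin> \<int>"
  shows "C_class \<rho>' (block_series c)"
proof -
  have nonint: "C_class s (block_series c)" if s: "0 < s" "s \<le> \<rho>" "s \<notin> \<int>" for s
  proof -
    have "s = nat \<lfloor>s\<rfloor> + frac s" using s by (simp add: frac_def)
    then have "block_decay (nat \<lfloor>s\<rfloor> + frac s) c" using block_decay_mono[OF c s(2)] by simp
    moreover have "0 < frac s" "frac s < 1" using s by (auto simp: frac_lt_1)
    ultimately show ?thesis unfolding C_class_def by (intro block_series_C_k_alpha)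
  qed
  show ?thesis
  proof (cases "\<rho>' \<in> \<int>")
    case False
    then show ?thesis using nonint \<rho>' by auto
  next
    case True
    \<comment> \<open>A non-integer between \<open>\<rho>'\<close> and \<open>\<rho>\<close>.\<close>
    define s where "s = min ((\<rho>' + \<rho>) / 2) (\<rho>' + 1 / 2)"
    have s: "\<rho>' < s" "s < \<rho>" "s < \<rho>' + 1" using True \<rho>' by (auto simp: s_def min_def)
    have "s \<notin> \<int>"
    proof
      assume "s \<in> \<int>"
      then have "s - \<rho>' \<in> \<int>" using True by simp
      then obtain z :: int where "s - \<rho>' = z" by (auto elim: Ints_cases)
      then have "0 < real_of_int z" "real_of_int z < 1" using s by linarith+
      then show False by simp
    qed
    then have "C_class s (block_series c)" using s \<rho>' by (intro nonint) auto
    then show ?thesis by (rule C_class_mono) (use s \<rho>'(1) in linarith)+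
  qed
qed

section \<open>Composition, exponential and logarithm\<close>

lemma C_class_1_iff: "C_class 1 f \<longleftrightarrow> C_k_alpha 1 0 f"
  by (simp add: C_class_def)

lemma C_class_compose:
  assumes "C_class \<rho> f" "C_class r g" "0 \<le> \<rho>" "\<rho> \<le> r" "1 \<le> r"
  shows "C_class \<rho> (\<lambda>x. f (g x))"
proof -
  have "C_class 1 g" "C_class \<rho> g" using assms(3-5) by (auto intro: C_class_mono[OF assms(2)])
  then show ?thesis
    using assms(1) C_k_alpha_compose[of "nat \<lfloor>\<rho>\<rfloor>" "frac \<rho>" f g] frac_lt_1[of \<rho>]
    by (simp only: C_class_1_iff) (simp add: C_class_def less_imp_le)
qed

lemma C_class_compose_linear:
  fixes f :: "'a::euclidean_space \<Rightarrow> 'b::real_normed_vector"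
  shows "bounded_linear L \<Longrightarrow> C_class r f \<Longrightarrow> C_class r (\<lambda>x. L (f x))"
  unfolding C_class_def by (rule C_k_alpha_compose_linear)

lemma C_class_add: "C_class r f \<Longrightarrow> C_class r g \<Longrightarrow> C_class r (\<lambda>x. f x + g x)"
  unfolding C_class_def by (rule C_k_alpha_add)

lemma C_class_mult:
  fixes f g :: "'a::euclidean_space \<Rightarrow> real"
  shows "C_class r f \<Longrightarrow> C_class r g \<Longrightarrow> C_class r (\<lambda>x. f x * g x)"
  using C_k_alpha_scaleR[of _ "frac r" f g] frac_lt_1[of r] by (simp add: C_class_def less_imp_le)

lemma C_class_linear: "bounded_linear L \<Longrightarrow> C_class r L"
  unfolding C_class_def by (simp add: C_k_alpha_bounded_linear frac_lt_1 less_imp_le)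

lemma C_class_exp:
  fixes f :: "'a::euclidean_space \<Rightarrow> real"
  assumes "C_class r f" shows "C_class r (\<lambda>x. exp (f x))"
  using assms frac_lt_1[of r] C_k_alpha_compose_smooth[of "nat \<lfloor>r\<rfloor>" "frac r" f UNIV "\<lambda>_. exp" 0]
  by (simp add: C_class_def less_imp_le)

lemma C_class_ln:
  fixes f :: "'a::euclidean_space \<Rightarrow> real"
  assumes "C_class r f" "\<And>x. 0 < f x" shows "C_class r (\<lambda>x. ln (f x))"
proof -
  \<comment> \<open>The logarithm and its successive derivatives.\<close>
  define G :: "nat \<Rightarrow> real \<Rightarrow> real" where
    "G j x = (case j of 0 \<Rightarrow> ln x | Suc i \<Rightarrow> (- 1) ^ i * fact i * inverse x ^ Suc i)" for j x
  have "(G j has_real_derivative G (Suc j) x) (at x)" if "x \<in> {0<..}" for j x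
  proof (cases j)
    case 0
    then show ?thesis using that by (auto simp: G_def[abs_def] inverse_eq_divide intro!: derivative_eq_intros)
  next
    case (Suc i)
    have "(inverse has_real_derivative - (inverse x ^ Suc (Suc 0))) (at x)"
      using that by (intro DERIV_inverse) auto
    then have "((\<lambda>x. (- 1) ^ i * fact i * inverse x ^ Suc i) has_real_derivative
        (- 1) ^ i * fact i * ((1 + real i) * (- (inverse x ^ Suc (Suc 0)) * inverse x ^ i))) (at x)"
      by (intro DERIV_cmult DERIV_power_Suc)
    moreover have "(- 1) ^ i * fact i * ((1 + real i) * (- (inverse x ^ Suc (Suc 0)) * inverse x ^ i)) = G (Suc j) x"
      by (simp add: Suc G_def algebra_simps)
    moreover have "G j = (\<lambda>x. (- 1) ^ i * fact i * inverse x ^ Suc i)" by (simp add: Suc G_def[abs_def])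
    ultimately show ?thesis by (simp only:)
  qed
  then have "C_k_alpha (nat \<lfloor>r\<rfloor>) (frac r) (\<lambda>x. G 0 (f x))"
    using C_k_alpha_compose_smooth[of "nat \<lfloor>r\<rfloor>" "frac r" f "{0<..}" G 0] assms frac_lt_1[of r]
    by (simp add: C_class_def less_imp_le)
  then show ?thesis by (simp add: C_class_def G_def)
qed

lemma C_class_continuous: "C_class r f \<Longrightarrow> continuous_on UNIV f"
  unfolding C_class_def by (rule C_k_alpha_continuous)

section \<open>The cohomological equation\<close>

text \<open>Cauchy--Schwarz on each block.  The exponents \<open>- r\<close> and \<open>\<tau>\<close> simply add.\<close>

lemma small_divisor_block_decay:
  fixes f :: "real ^ 'n::finite \<Rightarrow> complex"
  assumes f: "C_class r f" "periodic f" "0 \<le> r"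
    and \<omega>: "\<omega> \<in> Diophantine \<nu> \<tau>" "\<nu> > 0" "0 \<le> \<tau>"
  shows "block_decay (r - \<tau>) (\<lambda>k. fourier f k / (character k \<omega> - 1))"
proof -
  obtain A where A: "A \<ge> 0" "\<And>j. (\<Sum>k\<in>dyadic_block j. (norm (fourier f k))\<^sup>2) \<le> (A * 2 powr (- r * j))\<^sup>2"
    using fourier_block_decay[OF f] by blast
  define D where "D = 2 * 4 powr \<tau> / \<nu>"
  have D: "0 \<le> D" using \<omega>(2) by (simp add: D_def)
  have "(\<Sum>k\<in>dyadic_block j. norm (fourier f k / (character k \<omega> - 1))) \<le> A * D * 2 powr (- (r - \<tau>) * j)" for j
  proof -
    have "(\<Sum>k\<in>dyadic_block j. norm (fourier f k / (character k \<omega> - 1)))\<^sup>2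
        = (\<Sum>k\<in>dyadic_block j. norm (fourier f k) * (1 / norm (character k \<omega> - 1)))\<^sup>2"
      by (simp add: norm_divide)
    also have "\<dots> \<le> (\<Sum>k\<in>dyadic_block j. (norm (fourier f k))\<^sup>2) * (\<Sum>k\<in>dyadic_block j. (1 / norm (character k \<omega> - 1))\<^sup>2)"
      by (rule Cauchy_Schwarz_ineq_sum)
    also have "\<dots> \<le> (A * 2 powr (- r * j))\<^sup>2 * (D * 2 powr (\<tau> * j))\<^sup>2"
      using A(2)[of j] small_divisor_square_sum[OF \<omega>, of j] unfolding D_def
      by (intro mult_mono) (auto intro: sum_nonneg)
    also have "\<dots> = (A * D * (2 powr (- r * j) * 2 powr (\<tau> * j)))\<^sup>2"
      by (simp add: power_mult_distrib)
    also have "2 powr (- r * j) * 2 powr (\<tau> * j) = 2 powr (- (r - \<tau>) * j)"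
      by (simp add: algebra_simps flip: powr_add)
    finally show ?thesis by (rule power2_le_imp_le) (use A(1) D in auto)
  qed
  then show ?thesis unfolding block_decay_def using A(1) D by (intro exI[of _ "A * D"]) simp
qed

text \<open>Termwise, translation by \<open>\<omega>\<close> multiplies the coefficient at \<open>k\<close> by \<open>character k \<omega>\<close>, so \<open>u (x + \<omega>) - u x\<close> has
  the Fourier series of \<open>\<phi>\<close> without its mean.  That series converges absolutely, because its terms are at most
  twice those of \<open>u\<close>, and has the sum \<open>\<phi> - m\<close> by uniqueness of Fourier coefficients.  The solution \<open>u\<close> does
  not depend on \<open>\<rho>\<close>.\<close>

theorem cohomological_equation:
  fixes \<phi> :: "real ^ 'n::finite \<Rightarrow> real"
  assumes \<phi>: "C_class r \<phi>" "periodic \<phi>"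
    and \<omega>: "\<omega> \<in> Diophantine \<nu> \<tau>" "\<nu> > 0" and r: "\<tau> < r"
  obtains u m where "periodic u" "\<And>x. u (x + \<omega>) - u x = \<phi> x - m"
    "\<And>\<rho>. 0 < \<rho> \<Longrightarrow> \<rho> < r - \<tau> \<or> \<rho> = r - \<tau> \<and> r - \<tau> \<notin> \<int> \<Longrightarrow> C_class \<rho> u"
proof -
  have \<tau>: "1 \<le> \<tau>" using Diophantine_exponent_ge_1[OF \<omega>] .
  define f where "f x = complex_of_real (\<phi> x)" for x
  have f: "C_class r f" "periodic f"
    unfolding f_def using C_class_compose_linear[OF bounded_linear_of_real \<phi>(1)] periodic_compose[OF \<phi>(2)] by auto
  have cf: "continuous_on UNIV f" using f(1) by (rule C_class_continuous)
  define c where "c k = fourier f k / (character k \<omega> - 1)" for k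
  have c: "block_decay (r - \<tau>) c"
    unfolding c_def[abs_def] using small_divisor_block_decay[OF f _ \<omega>] r \<tau> by simp
  have cne: "fourier f k = c k * (character k \<omega> - 1)" if "k \<noteq> 0" for k
    using Diophantine_character_neq_1[OF \<omega> that] by (simp add: c_def)
  have ff: "block_decay (r - \<tau>) (fourier f)"
  proof -
    obtain C where C: "C \<ge> 0" "\<And>j. (\<Sum>k\<in>dyadic_block j. norm (c k)) \<le> C * 2 powr (- (r - \<tau>) * j)"
      using c unfolding block_decay_def by blast
    have "(\<Sum>k\<in>dyadic_block j. norm (fourier f k)) \<le> 2 * C * 2 powr (- (r - \<tau>) * j)" for j
    proof -
      have "norm (fourier f k) \<le> 2 * norm (c k)" if "k \<in> dyadic_block j" for k
      proof -
        have "k \<noteq> 0" using that zero_notin_dyadic_block by metis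
        have "norm (character k \<omega> - 1) \<le> 2"
          using norm_triangle_ineq4[of "character k \<omega>" 1] by simp
        then have "norm (c k) * norm (character k \<omega> - 1) \<le> norm (c k) * 2" by (rule mult_left_mono) simp
        then show ?thesis by (simp add: cne[OF \<open>k \<noteq> 0\<close>] norm_mult)
      qed
      then have "(\<Sum>k\<in>dyadic_block j. norm (fourier f k)) \<le> 2 * (\<Sum>k\<in>dyadic_block j. norm (c k))"
        unfolding sum_distrib_left by (rule sum_mono)
      then show ?thesis using C(2)[of j] by linarith
    qed
    then show ?thesis unfolding block_decay_def using C(1) by (intro exI[of _ "2 * C"]) simp
  qed
  have \<rho>: "0 < r - \<tau>" using r by simp
  define U where "U = block_series c"
  have "U (x + \<omega>) - U x = block_series (fourier f) x" for x
  proof -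
    have "(\<Sum>k\<in>dyadic_block j. c k * character k (x + \<omega>)) - (\<Sum>k\<in>dyadic_block j. c k * character k x)
        = (\<Sum>k\<in>dyadic_block j. fourier f k * character k x)" for j
      unfolding sum_subtractf[symmetric]
    proof (intro sum.cong refl)
      fix k :: "int ^ 'n" assume "k \<in> dyadic_block j"
      then have "k \<noteq> 0" using zero_notin_dyadic_block by metis
      then show "c k * character k (x + \<omega>) - c k * character k x = fourier f k * character k x"
        by (simp add: cne character_add algebra_simps)
    qed
    then show ?thesis
      using sums_diff[OF block_series_sums[OF c \<rho>, of "x + \<omega>"] block_series_sums[OF c \<rho>, of x]]
        block_series_sums[OF ff \<rho>, of x] unfolding U_def by (simp add: sums_unique2)
  qed
  moreover have "f x = fourier f 0 + block_series (fourier f) x" for x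
  proof -
    define g where "g x = f x - (fourier f 0 * character 0 x + block_series (fourier f) x)" for x
    have c1: "continuous_on UNIV (\<lambda>x. fourier f 0 * character 0 x)" by (intro continuous_intros)
    have c2: "continuous_on UNIV (block_series (fourier f))" using continuous_on_block_series[OF ff \<rho>] .
    have "fourier g k = 0" for k
      unfolding g_def fourier_diff[OF cf continuous_on_add[OF c1 c2]] fourier_add[OF c1 c2]
        fourier_mult_left fourier_block_series[OF ff \<rho>] fourier_character by simp
    moreover have "continuous_on UNIV g"
      unfolding g_def by (intro continuous_on_diff cf continuous_on_add c1 c2)
    moreover have "periodic g"
      unfolding g_def
      using periodic_compose2[OF f(2) periodic_block_series, of "\<lambda>a b. a - (fourier f 0 * 1 + b)" "fourier f"] by simp
    ultimately have "g x = 0" by (intro null_fourier_imp_0) (simp add: null_fourier_def)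
    then show ?thesis by (simp add: g_def)
  qed
  ultimately have eq: "U (x + \<omega>) - U x = f x - fourier f 0" for x by simp
  show thesis
  proof (rule that[of "\<lambda>x. Re (U x)" "Re (fourier f 0)"])
    show "periodic (\<lambda>x. Re (U x))" unfolding U_def by (rule periodic_compose[OF periodic_block_series])
    show "Re (U (x + \<omega>)) - Re (U x) = \<phi> x - Re (fourier f 0)" for x
      using arg_cong[OF eq[of x], of Re] by (simp add: f_def)
    show "C_class \<rho>' (\<lambda>x. Re (U x))" if "0 < \<rho>'" "\<rho>' < r - \<tau> \<or> \<rho>' = r - \<tau> \<and> r - \<tau> \<notin> \<int>" for \<rho>'
      unfolding U_def
      by (rule C_class_compose_linear[OF bounded_linear_Re block_series_C_class[OF c \<rho> that]])
  qed
qed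

section \<open>Skew products over the torus\<close>

lemma constant_sign:
  fixes f :: "'a::euclidean_space \<Rightarrow> real"
  assumes "continuous_on UNIV f" "\<And>x. f x \<noteq> 0"
  obtains s :: real where "s * s = 1" "\<And>x. 0 < s * f x"
proof (cases "\<exists>x. 0 < f x")
  case True
  then obtain x where x: "0 < f x" by blast
  have "0 < f y" for y
  proof (rule ccontr)
    assume "\<not> 0 < f y"
    then have "0 \<in> range f"
      using connected_continuous_image[OF assms(1)] x connectedD_interval[of "range f" "f y" "f x" 0] by auto
    then show False using assms(2) by (metis imageE)
  qed
  then show thesis using that[of 1] by simp
next
  case False
  then have "f x < 0" for x using assms(2)[of x] by (metis linorder_neqE_linordered_idom)
  then show thesis using that[of "- 1"] by simp
qed

text \<open>A sum of two maps, one for each factor of the product, each of which only involves compositions with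
  linear maps and a product of real functions.\<close>

lemma C_class_cylinder_lift:
  fixes L :: "real ^ 'n::finite \<Rightarrow> real ^ 'n" and w :: "real ^ 'n \<Rightarrow> real"
  assumes "C_class \<rho> L" "C_class \<rho> w" "0 \<le> \<rho>"
  shows "C_class \<rho> (\<lambda>p. (L (fst p), w (fst p) * snd p) :: (real ^ 'n) \<times> real)"
proof -
  have fst: "C_class (max \<rho> 1) (fst :: (real ^ 'n) \<times> real \<Rightarrow> _)" by (rule C_class_linear[OF bounded_linear_fst])
  have "C_class \<rho> (\<lambda>p :: (real ^ 'n) \<times> real. L (fst p))" "C_class \<rho> (\<lambda>p :: (real ^ 'n) \<times> real. w (fst p))"
    using assms(3) by (auto intro!: C_class_compose[OF _ fst] assms(1,2))
  then have "C_class \<rho> (\<lambda>p. (L (fst p), 0) + (0, w (fst p) * snd p) :: (real ^ 'n) \<times> real)"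
    by (intro C_class_add C_class_compose_linear[where L = "\<lambda>y. (y, 0)"] C_class_compose_linear[where L = "\<lambda>y. (0, y)"]
        C_class_mult C_class_linear[OF bounded_linear_snd] bounded_linear_Pair bounded_linear_ident bounded_linear_zero)
  then show ?thesis by simp
qed

lemma cyl_proj_Pair: "cyl_proj (x, t) = (torus_proj x, t)"
  by (simp add: cyl_proj_def)

lemma torus_proj_rep_torus: "torus_proj (rep_torus \<sigma>) = \<sigma>"
  by (rule Quotient_abs_rep[OF Quotient_torus])

text \<open>The inverse has the same form, with \<open>inv h\<close> in the base and \<open>exp (- u)\<close>, composed with \<open>inv h\<close>, in the
  fibre.\<close>

lemma cyl_diffeo_skew_product:
  fixes h :: "'n::finite torus \<Rightarrow> 'n torus" and u :: "real ^ 'n \<Rightarrow> real"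
  assumes h: "torus_diffeo r h" and r: "1 \<le> r"
    and u: "C_class \<rho> u" and \<rho>: "0 \<le> \<rho>" "\<rho> \<le> r"
    and b: "\<And>x. b (torus_proj x) = exp (u x)"
  shows "cyl_diffeo \<rho> (\<lambda>(\<sigma>, t). (h \<sigma>, b \<sigma> * t))" (is "cyl_diffeo \<rho> ?H")
proof -
  have bij: "bij h" using h by (simp add: torus_diffeo_def)
  obtain L where L: "C_class r L" "\<And>x. h (torus_proj x) = torus_proj (L x)"
    using h unfolding torus_diffeo_def C_map_def by blast
  obtain M where M: "C_class r M" "\<And>x. inv h (torus_proj x) = torus_proj (M x)"
    using h unfolding torus_diffeo_def C_map_def by blast
  have b0: "b \<sigma> \<noteq> 0" for \<sigma> using b[of "rep_torus \<sigma>"] by (simp add: torus_proj_rep_torus)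
  define K where "K = (\<lambda>(\<sigma>, t). (inv h \<sigma>, t / b (inv h \<sigma>)))"
  have HK: "?H \<circ> K = id" "K \<circ> ?H = id"
    using bij b0 by (auto simp: K_def fun_eq_iff bij_is_inj bij_is_surj surj_f_inv_f)
  then have bijH: "bij ?H" using o_bij by blast
  have invH: "inv ?H = K" using HK by (metis inv_unique_comp)
  have "C_map cyl_proj cyl_proj \<rho> ?H"
    unfolding C_map_def
  proof (intro exI conjI allI)
    show "C_class \<rho> (\<lambda>p. (L (fst p), exp (u (fst p)) * snd p) :: (real ^ 'n) \<times> real)"
      using C_class_mono[OF L(1) \<rho>(2,1)] C_class_exp[OF u] \<rho>(1) by (rule C_class_cylinder_lift)
    show "?H (cyl_proj p) = cyl_proj (L (fst p), exp (u (fst p)) * snd p)" for p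
      by (cases p) (simp add: cyl_proj_Pair L(2) b)
  qed
  moreover have "C_map cyl_proj cyl_proj \<rho> (inv ?H)"
    unfolding C_map_def
  proof (intro exI conjI allI)
    have "C_class \<rho> (\<lambda>x. u (M x))" using C_class_compose[OF u M(1) \<rho> r] .
    then have "C_class \<rho> (\<lambda>x. exp (- u (M x)))"
      by (intro C_class_exp C_class_compose_linear[OF bounded_linear_minus[OF bounded_linear_ident]])
    then show "C_class \<rho> (\<lambda>p. (M (fst p), exp (- u (M (fst p))) * snd p) :: (real ^ 'n) \<times> real)"
      using C_class_mono[OF M(1) \<rho>(2,1)] \<rho>(1) by (intro C_class_cylinder_lift)
    show "inv ?H (cyl_proj p) = cyl_proj (M (fst p), exp (- u (M (fst p))) * snd p)" for p
      unfolding invH by (cases p) (simp add: K_def cyl_proj_Pair M(2) b exp_minus field_simps)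
  qed
  ultimately show ?thesis using bijH by (simp add: cyl_diffeo_def)
qed

theorem theorem2p5:
  fixes \<psi> :: "'n::finite torus \<times> real \<Rightarrow> 'n torus \<times> real"
    and v h :: "'n torus \<Rightarrow> 'n torus"
    and a :: "'n torus \<Rightarrow> real"
    and \<Omega> :: "real ^ 'n"
    and r \<nu> \<tau> :: real
  assumes "\<And>\<sigma> t. \<psi> (\<sigma>, t) = (v \<sigma>, a \<sigma> * t)"
    and "torus_diffeo r v"
    and "torus_C r a" and "\<And>\<sigma>. a \<sigma> \<noteq> 0"
    and "torus_diffeo r h"
    and "\<nu> > 0" and "\<Omega> \<in> Diophantine \<nu> \<tau>"
    and "\<And>\<sigma>. (inv h \<circ> v \<circ> h) \<sigma> = \<sigma> + torus_proj \<Omega>"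
    and "\<tau> < r"
  shows "\<exists>(b :: 'n torus \<Rightarrow> real) (\<kappa> :: real). (\<forall>\<sigma>. b \<sigma> \<noteq> 0) \<and> \<kappa> \<noteq> 0 \<and>
           (let H = (\<lambda>(\<sigma>, t). (h \<sigma>, b \<sigma> * t)) in
              (r - \<tau> \<notin> \<int> \<longrightarrow> torus_C (r - \<tau>) b \<and> cyl_diffeo (r - \<tau>) H) \<and>
              (r - \<tau> \<in> \<int> \<longrightarrow> (\<forall>\<rho>. 0 < \<rho> \<and> \<rho> < r - \<tau> \<longrightarrow> torus_C \<rho> b \<and> cyl_diffeo \<rho> H)) \<and>
              (\<forall>\<sigma> t. (\<psi> \<circ> H) (\<sigma>, t) = H (\<sigma> + torus_proj \<Omega>, \<kappa> * t)))"
proof -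
  have \<tau>: "1 \<le> \<tau>" using Diophantine_exponent_ge_1 assms(6,7) by blast
  then have r: "1 \<le> r" using assms(9) by simp
  have bij: "bij h" using assms(5) by (simp add: torus_diffeo_def)
  obtain A where A: "C_class r A" "\<And>x. a (torus_proj x) = A x"
    using assms(3) unfolding torus_C_def C_map_def by auto
  obtain L where L: "C_class r L" "\<And>x. h (torus_proj x) = torus_proj (L x)"
    using assms(5) unfolding torus_diffeo_def C_map_def by blast
  define f where "f x = A (L x)" for x
  have f: "f x = a (h (torus_proj x))" for x by (simp add: f_def L A)
  have fC: "C_class r f" unfolding f_def[abs_def] using C_class_compose[OF A(1) L(1)] r by simp
  obtain s :: real where s: "s * s = 1" "\<And>x. 0 < s * f x"
    using constant_sign[OF C_class_continuous[OF fC]] f assms(4) by metis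
  define \<phi> where "\<phi> x = ln (s * f x)" for x
  have "C_class r \<phi>"
    unfolding \<phi>_def[abs_def] using C_class_compose_linear[OF bounded_linear_mult_right fC] s(2)
    by (intro C_class_ln)
  moreover have "periodic \<phi>" by (simp add: periodic_def \<phi>_def f)
  ultimately obtain u m where u: "periodic u" "\<And>x. u (x + \<Omega>) - u x = \<phi> x - m"
      "\<And>\<rho>. 0 < \<rho> \<Longrightarrow> \<rho> < r - \<tau> \<or> \<rho> = r - \<tau> \<and> r - \<tau> \<notin> \<int> \<Longrightarrow> C_class \<rho> u"
    using cohomological_equation[of r \<phi>, OF _ _ assms(7,6,9)] by metis
  define b where "b \<sigma> = exp (u (rep_torus \<sigma>))" for \<sigma>
  have b: "b (torus_proj x) = exp (u x)" for x
    using u(1) torus_proj_rep_torus unfolding b_def periodic_def by metis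
  define \<kappa> where "\<kappa> = s * exp m"
  have reg: "torus_C \<rho> b \<and> cyl_diffeo \<rho> (\<lambda>(\<sigma>, t). (h \<sigma>, b \<sigma> * t))"
    if \<rho>: "0 < \<rho>" "\<rho> < r - \<tau> \<or> \<rho> = r - \<tau> \<and> r - \<tau> \<notin> \<int>" for \<rho>
  proof
    have "C_class \<rho> u" using u(3) \<rho> by blast
    then show "torus_C \<rho> b"
      unfolding torus_C_def C_map_def using C_class_exp b by auto
    show "cyl_diffeo \<rho> (\<lambda>(\<sigma>, t). (h \<sigma>, b \<sigma> * t))"
      using assms(5) r \<open>C_class \<rho> u\<close> _ _ b
      by (rule cyl_diffeo_skew_product) (use \<rho> \<tau> in auto)
  qed
  have conjugacy: "(\<psi> \<circ> (\<lambda>(\<sigma>, t). (h \<sigma>, b \<sigma> * t))) (\<sigma>, t)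
      = (\<lambda>(\<sigma>, t). (h \<sigma>, b \<sigma> * t)) (\<sigma> + torus_proj \<Omega>, \<kappa> * t)" for \<sigma> t
  proof -
    define x where "x = rep_torus \<sigma>"
    have x: "\<sigma> = torus_proj x" by (simp add: x_def torus_proj_rep_torus)
    have "v (h \<sigma>) = h (\<sigma> + torus_proj \<Omega>)"
      using assms(8)[of \<sigma>] bij by (metis bij_is_surj comp_apply surj_f_inv_f)
    moreover have "a (h \<sigma>) * b \<sigma> = b (\<sigma> + torus_proj \<Omega>) * \<kappa>"
    proof -
      have "a (h \<sigma>) = s * exp (\<phi> x)"
        using s by (simp add: \<phi>_def x f flip: mult.assoc)
      moreover have "u (x + \<Omega>) + m = \<phi> x + u x" using u(2)[of x] by simp
      then have "exp (u (x + \<Omega>)) * exp m = exp (\<phi> x) * exp (u x)" by (simp flip: exp_add)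
      ultimately show ?thesis by (simp add: x b torus_proj_add \<kappa>_def)
    qed
    ultimately show ?thesis using assms(1) by simp
  qed
  have "\<kappa> \<noteq> 0" using s(1) by (auto simp: \<kappa>_def)
  moreover have "b \<sigma> \<noteq> 0" for \<sigma> by (simp add: b_def)
  ultimately show ?thesis
    unfolding Let_def using reg conjugacy assms(9) by (intro exI[of _ b] exI[of _ \<kappa>]) auto
qed

end
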